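(* Let $S$ be a finite nonempty set of primes and let $H\subseteq \mathrm{GL}_2(\mathbb{Z}_S)$ be a minimal group of finite level. Then $S=\{2\}$.
   Context: For a finite set $S$ of primes, $\mathbb{Z}_S=\varprojlim \mathbb{Z}/n\mathbb{Z}$, the inverse limit with respect to divisibility over positive integers $n$ divisible only by primes in $S$; thus $\mathbb{Z}_S=\prod_{p\in S}\mathbb{Z}_p$ and $\mathrm{GL}_2(\mathbb{Z}_S)=\prod_{p\in S}\mathrm{GL}_2(\mathbb{Z}_p)$, with the profinite topology. A subgroup $H\subseteq \mathrm{GL}_2(\mathbb{Z}_S)$ of finite index is called minimal if $\det(H)=\mathbb{Z}_S^\times$, but for every maximal closed subgroup $M\subsetneq H$ one has $\det(M)\subsetneq \mathbb{Z}_S^\times$. For a positive integer $n$ divisible only by primes in $S$, let $\rho_n:\mathrm{GL}_2(\mathbb{Z}_S)\to \mathrm{GL}_2(\mathbb{Z}/n\mathbb{Z})$ be the reduction map. A subgroup $G\subseteq\mathrm{GL}_2(\mathbb{Z}_S)$ has finite level if there is a positive integer $n$ divisible only by primes in $S$ such that $G=\rho_n^{-1}(\rho_n(G))$. *)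

theory Defs
  imports
    "HOL-Analysis.Finite_Cartesian_Product"
    "HOL-Analysis.Function_Topology"
    "HOL-Algebra.Coset"
    "HOL-Algebra.IntRing"
    "HOL-Computational_Algebra.Primes"
begin

definition S_numbers :: "nat set \<Rightarrow> nat set" where
  "S_numbers S = {n. n > 0 \<and> prime_factors n \<subseteq> S}"

text \<open>
  The inverse limit of the rings \<open>\<int>/n\<int>\<close>. Elements of \<open>ZFact n\<close> are cosets of \<open>n\<int>\<close>, and for
  \<open>m dvd n\<close> the transition map \<open>\<int>/n\<int> \<rightarrow> \<int>/m\<int>\<close> sends a coset of \<open>n\<int>\<close> to the only coset of
  \<open>m\<int>\<close> containing it; so compatibility of a family is expressed by inclusion of cosets.
\<close>

definition Z_S :: "nat set \<Rightarrow> (nat \<Rightarrow> int set) ring" where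
  "Z_S S = \<lparr>
     carrier = {x \<in> (\<Pi>\<^sub>E n\<in>S_numbers S. carrier (ZFact (int n))).
                  \<forall>n\<in>S_numbers S. \<forall>m\<in>S_numbers S. m dvd n \<longrightarrow> x n \<subseteq> x m},
     mult = (\<lambda>x y. \<lambda>n\<in>S_numbers S. x n \<otimes>\<^bsub>ZFact (int n)\<^esub> y n),
     one = (\<lambda>n\<in>S_numbers S. \<one>\<^bsub>ZFact (int n)\<^esub>),
     zero = (\<lambda>n\<in>S_numbers S. \<zero>\<^bsub>ZFact (int n)\<^esub>),
     add = (\<lambda>x y. \<lambda>n\<in>S_numbers S. x n \<oplus>\<^bsub>ZFact (int n)\<^esub> y n)\<rparr>"

definition Mat2 :: "('a, 'b) ring_scheme \<Rightarrow> ('a^2^2) monoid" where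
  "Mat2 R = \<lparr>
     carrier = {A. \<forall>i j. A $ i $ j \<in> carrier R},
     mult = (\<lambda>A B. \<chi> i j. (A $ i $ 1 \<otimes>\<^bsub>R\<^esub> B $ 1 $ j) \<oplus>\<^bsub>R\<^esub> (A $ i $ 2 \<otimes>\<^bsub>R\<^esub> B $ 2 $ j)),
     one = (\<chi> i j. if i = j then \<one>\<^bsub>R\<^esub> else \<zero>\<^bsub>R\<^esub>)\<rparr>"

definition GL2 :: "('a, 'b) ring_scheme \<Rightarrow> ('a^2^2) monoid" where
  "GL2 R = units_of (Mat2 R)"

definition det2 :: "('a, 'b) ring_scheme \<Rightarrow> 'a^2^2 \<Rightarrow> 'a" where
  "det2 R A = (A $ 1 $ 1 \<otimes>\<^bsub>R\<^esub> A $ 2 $ 2) \<ominus>\<^bsub>R\<^esub> (A $ 1 $ 2 \<otimes>\<^bsub>R\<^esub> A $ 2 $ 1)"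

definition reduction :: "nat \<Rightarrow> (nat \<Rightarrow> int set)^2^2 \<Rightarrow> (int set)^2^2" where
  "reduction n A = (\<chi> i j. (A $ i $ j) n)"

text \<open>
  The profinite topology of \<open>GL2 (Z_S S)\<close>, as the inverse limit of the finite discrete groups
  \<open>GL2 (ZFact n)\<close>: the initial topology for all the reduction maps.
\<close>

definition GL2_topology :: "nat set \<Rightarrow> ((nat \<Rightarrow> int set)^2^2) topology" where
  "GL2_topology S = pullback_topology (carrier (GL2 (Z_S S)))
     (\<lambda>A. \<lambda>n\<in>S_numbers S. reduction n A)
     (product_topology (\<lambda>n. discrete_topology (carrier (GL2 (ZFact (int n))))) (S_numbers S))"

definition closed_subgroup_of :: "nat set \<Rightarrow> ((nat \<Rightarrow> int set)^2^2) set \<Rightarrow> ((nat \<Rightarrow> int set)^2^2) set \<Rightarrow> bool" where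
  "closed_subgroup_of S H K \<longleftrightarrow>
     K \<subseteq> H \<and> subgroup K (GL2 (Z_S S)) \<and> closedin (subtopology (GL2_topology S) H) K"

text \<open>Maximal among the proper closed subgroups of \<open>H\<close>.\<close>

definition maximal_closed_subgroup_of ::
    "nat set \<Rightarrow> ((nat \<Rightarrow> int set)^2^2) set \<Rightarrow> ((nat \<Rightarrow> int set)^2^2) set \<Rightarrow> bool" where
  "maximal_closed_subgroup_of S H M \<longleftrightarrow>
     closed_subgroup_of S H M \<and> M \<noteq> H \<and>
     (\<forall>K. closed_subgroup_of S H K \<and> M \<subseteq> K \<longrightarrow> K = M \<or> K = H)"

definition minimal_group :: "nat set \<Rightarrow> ((nat \<Rightarrow> int set)^2^2) set \<Rightarrow> bool" where
  "minimal_group S H \<longleftrightarrow>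
     subgroup H (GL2 (Z_S S)) \<and>
     finite (rcosets\<^bsub>GL2 (Z_S S)\<^esub> H) \<and>
     det2 (Z_S S) ` H = Units (Z_S S) \<and>
     (\<forall>M. maximal_closed_subgroup_of S H M \<longrightarrow> det2 (Z_S S) ` M \<subset> Units (Z_S S))"

definition finite_level :: "nat set \<Rightarrow> ((nat \<Rightarrow> int set)^2^2) set \<Rightarrow> bool" where
  "finite_level S G \<longleftrightarrow>
     (\<exists>n\<in>S_numbers S. G = {A \<in> carrier (GL2 (Z_S S)). reduction n A \<in> reduction n ` G})"

end

theory Submission
  imports
    Defs
    "HOL-Analysis.Cartesian_Space"
    "HOL-Algebra.Zassenhaus"
    "HOL-Algebra.Sylow"
    "HOL-Algebra.Multiplicative_Group"
    "HOL-Number_Theory.Residue_Primitive_Roots"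
begin

text \<open>
  Why no odd prime \<open>q\<close> can lie in \<open>S\<close>. Minimality says that a proper open subgroup of \<open>H\<close> never
  has full determinant, in other words that the kernel of \<open>det\<close> on \<open>H\<close> lies in the Frattini
  subgroup. As \<open>det\<close> has abelian image, Frattini's argument makes every Sylow subgroup of a finite
  quotient of \<open>H\<close> normal, so that elements of prime power order for different primes commute
  (\<open>commute_if_no_proper_subgroup_onto\<close>). The passage from \<open>H\<close> to its image modulo \<open>N\<close> is
  \<open>minimal_group_no_proper_subgroup_onto\<close>: a proper subgroup of the image with full determinant
  pulls back to a closed subgroup of \<open>H\<close>, which lies in a maximal one, and multiplying by matrices
  \<open>diag(w, 1)\<close> with \<open>w\<close> congruent to \<open>1\<close> modulo \<open>N\<close> shows that the determinant of the pullback is full.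

  Let \<open>n\<close> be a level of \<open>H\<close> and \<open>N = n q\<close>. Then \<open>H\<close> contains the elementary matrices with
  off-diagonal entry \<open>n\<close>, upper and lower, and modulo \<open>N\<close> their \<open>q\<close>-th power is trivial. An element
  of \<open>2\<close>-power order in the image of \<open>H\<close> modulo \<open>N\<close> commutes with both; comparing entries, it is
  scalar modulo \<open>q\<close>, so its determinant is a square modulo \<open>q\<close>. On the other hand \<open>H\<close> contains a
  matrix whose determinant is an integer \<open>u\<close>, prime to all of \<open>S\<close>, that is a primitive root modulo
  \<open>q\<close>. A suitable odd power of this matrix has \<open>2\<close>-power order modulo \<open>N\<close>, and its determinant, an
  odd power of \<open>u\<close>, is not a square modulo \<open>q\<close>.
\<close>

section \<open>Finite groups in which no proper subgroup has the full abelian image\<close>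

text \<open>
  An orbit with more than one point has size a positive power of \<open>p\<close>, so if there
  were no fixed point then \<open>p\<close> would divide the number of points.
\<close>
lemma (in group_action) p_group_fixed_point:
  assumes "prime p" and "order G = p ^ k" and "finite E" and "\<not> p dvd card E"
  shows "\<exists>x\<in>E. \<forall>g\<in>carrier G. \<phi> g x = x"
proof (rule ccontr)
  assume no_fix: "\<not> ?thesis"
  have "p dvd card orb" if orb: "orb \<in> orbits G E \<phi>" for orb
  proof -
    obtain x where x: "x \<in> E" "orb = orbit G \<phi> x"
      using orb unfolding orbits_def by blast
    have "card orb dvd p ^ k"
      using orbit_stabilizer_theorem[OF x(1)] assms(2) x(2) by (metis dvd_triv_left)
    moreover have "card orb \<noteq> 1"
    proof
      assume "card orb = 1"
      then have "orb = {x}"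
        using orbit_refl[OF x(1)] x(2) by (metis card_1_singletonE singletonD)
      then have "\<forall>g\<in>carrier G. \<phi> g x = x"
        using x(2) by (auto simp: orbit_def)
      with no_fix x(1) show False by blast
    qed
    ultimately show ?thesis
      using assms(1) by (metis divides_primepow_nat dvd_power neq0_conv power_0)
  qed
  then have "p dvd (\<Sum>orb\<in>orbits G E \<phi>. card orb)"
    by (rule dvd_sum)
  also have "(\<Sum>orb\<in>orbits G E \<phi>. card orb) = card E"
    using disjoint_sum[OF assms(3), of "\<lambda>_. 1::nat"] by simp
  finally show False using assms(4) by simp
qed

text \<open>
  Right translation by the inverse turns the natural right action on right cosets into a left
  action, which is what \<^locale>\<open>group_action\<close> describes.
\<close>
lemma (in group) right_translation_action:
  assumes P: "subgroup P G" and Q: "subgroup Q G"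
  shows "group_action (G\<lparr>carrier := Q\<rparr>) (rcosets P) (\<lambda>q. \<lambda>C\<in>rcosets P. C #> inv q)"
proof -
  let ?X = "rcosets P" and ?\<phi> = "\<lambda>q. \<lambda>C\<in>rcosets P. C #> inv q"
  have PG: "P \<subseteq> carrier G" using P by (rule subgroup.subset)
  have sub: "C \<subseteq> carrier G" if "C \<in> ?X" for C
    using that rcosets_part_G[OF P] by auto
  have closed: "C #> g \<in> ?X" if "C \<in> ?X" "g \<in> carrier G" for C g
  proof -
    obtain x where "x \<in> carrier G" "C = P #> x"
      using \<open>C \<in> ?X\<close> by (auto simp: RCOSETS_def)
    then show ?thesis
      using rcosetsI[OF PG, of "x \<otimes> g"] PG that(2) by (simp add: coset_mult_assoc)
  qed
  have Bij: "?\<phi> q \<in> Bij ?X" if "q \<in> carrier G" for q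
  proof -
    have "bij_betw (\<lambda>C. C #> inv q) ?X ?X"
      by (rule bij_betwI[where g = "\<lambda>C. C #> q"])
         (auto simp: closed that coset_mult_assoc sub)
    then show ?thesis by (auto simp: Bij_def cong: bij_betw_cong)
  qed
  have mult: "?\<phi> (q \<otimes> r) = compose ?X (?\<phi> q) (?\<phi> r)" if "q \<in> carrier G" "r \<in> carrier G" for q r
    using that by (auto simp: compose_def closed coset_mult_assoc sub inv_mult_group intro!: restrict_ext)
  have QG: "q \<in> carrier G" if "q \<in> Q" for q using Q that by (rule subgroup.mem_carrier)
  have hom: "?\<phi> \<in> hom (G\<lparr>carrier := Q\<rparr>) (BijGroup ?X)"
    by (rule homI) (auto simp: BijGroup_def Bij QG mult)
  show ?thesis
    unfolding group_action_def group_hom_def group_hom_axioms_def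
    using hom subgroup_imp_group[OF Q] group_BijGroup by blast
qed

text \<open>
  For a Sylow subgroup \<open>P\<close> this is the second Sylow theorem: a fixed point
  \<open>P x\<close> of \<open>Q\<close> acting on the cosets of \<open>P\<close> satisfies
  \<open>P x q = P x\<close> for all \<open>q\<close> in \<open>Q\<close>. There is a fixed
  point because the number of cosets is prime to \<open>p\<close>.
\<close>
lemma (in group) p_subgroup_conjugate_into_sylow:
  assumes fin: "finite (carrier G)" and p: "prime p"
    and P: "subgroup P G" and index: "\<not> p dvd card (rcosets P)"
    and Q: "subgroup Q G" and cardQ: "card Q = p ^ k"
  shows "\<exists>x\<in>carrier G. \<forall>q\<in>Q. x \<otimes> q \<otimes> inv x \<in> P"
proof -
  interpret act: group_action "G\<lparr>carrier := Q\<rparr>" "rcosets P" "\<lambda>q. \<lambda>C\<in>rcosets P. C #> inv q"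
    using P Q by (rule right_translation_action)
  have "finite (rcosets P)"
    using fin by (simp add: RCOSETS_def)
  then obtain C where C: "C \<in> rcosets P" "\<And>q. q \<in> Q \<Longrightarrow> C #> inv q = C"
    using act.p_group_fixed_point[OF p, of k] cardQ index by (auto simp: order_def)
  then obtain x where x: "x \<in> carrier G" "C = P #> x"
    by (auto simp: RCOSETS_def)
  have "x \<otimes> q \<otimes> inv x \<in> P" if q: "q \<in> Q" for q
  proof -
    have qG: "q \<in> carrier G" using Q q by (rule subgroup.mem_carrier)
    have "C #> inv (inv q) = C" using C(2) subgroup.m_inv_closed[OF Q q] by blast
    then have "P #> (x \<otimes> q) = P #> x"
      using x qG subgroup.subset[OF P] by (simp add: coset_mult_assoc)
    then have "x \<otimes> q \<in> P #> x"
      using rcos_self[OF _ P, of "x \<otimes> q"] x(1) qG by simp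
    then show ?thesis
      using subgroup.rcos_module_imp[OF P is_group x(1)] by blast
  qed
  with x(1) show ?thesis by blast
qed

lemma (in group) inv_mult_cancel_left:
  assumes "a \<in> carrier G" and "z \<in> carrier G"
  shows "inv a \<otimes> (a \<otimes> z) = z"
  using assms by (simp flip: m_assoc)

text \<open>
  This is the normalizer of \<open>P\<close>, in the elementwise form that Sylow conjugacy
  produces. For finite \<open>P\<close> a conjugate contained in \<open>P\<close> equals
  \<open>P\<close>, which gives closure under inverses.
\<close>
lemma (in group) self_conjugating_elements_subgroup:
  assumes P: "subgroup P G" and fin: "finite P"
  shows "subgroup {x \<in> carrier G. \<forall>y\<in>P. x \<otimes> y \<otimes> inv x \<in> P} G"
proof (rule subgroupI)
  have PG: "y \<in> carrier G" if "y \<in> P" for y using P that by (rule subgroup.mem_carrier)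
  let ?N = "{x \<in> carrier G. \<forall>y\<in>P. x \<otimes> y \<otimes> inv x \<in> P}"
  show "?N \<subseteq> carrier G" by blast
  have "\<one> \<in> ?N" using PG by simp
  then show "?N \<noteq> {}" by blast
  fix a assume a: "a \<in> ?N"
  have "inj_on (\<lambda>y. a \<otimes> y \<otimes> inv a) P"
    using a PG by (intro inj_onI) (metis (mono_tags, lifting) mem_Collect_eq conjugation_is_inj)
  moreover have "(\<lambda>y. a \<otimes> y \<otimes> inv a) ` P \<subseteq> P" using a by blast
  ultimately have onto: "(\<lambda>y. a \<otimes> y \<otimes> inv a) ` P = P"
    using fin by (simp add: endo_inj_surj)
  have "inv a \<otimes> y \<otimes> inv (inv a) \<in> P" if y: "y \<in> P" for y
  proof -
    obtain z where z: "z \<in> P" "y = a \<otimes> z \<otimes> inv a" using onto y by blast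
    have "inv a \<otimes> y \<otimes> inv (inv a) = z"
      unfolding z(2) using a PG[OF z(1)] by (simp add: m_assoc inv_mult_cancel_left)
    with z(1) show ?thesis by simp
  qed
  with a show "inv a \<in> ?N" by simp
  fix b assume b: "b \<in> ?N"
  have "a \<otimes> b \<otimes> y \<otimes> inv (a \<otimes> b) \<in> P" if "y \<in> P" for y
  proof -
    have "a \<otimes> (b \<otimes> y \<otimes> inv b) \<otimes> inv a \<in> P" using a b that by blast
    also have "a \<otimes> (b \<otimes> y \<otimes> inv b) \<otimes> inv a = a \<otimes> b \<otimes> y \<otimes> inv (a \<otimes> b)"
      using a b PG[OF that] by (simp add: m_assoc inv_mult_group)
    finally show ?thesis .
  qed
  with a b show "a \<otimes> b \<in> ?N" by simp
qed

text \<open>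
  Frattini's argument. As \<open>G\<close> is abelian modulo \<open>A\<close>, the conjugate
  of \<open>P\<close> by \<open>x\<close> stays inside \<open>A P\<close>. There both are
  Sylow subgroups, hence conjugate by some element of \<open>A P = P A\<close>, and its factor
  in \<open>P\<close> can be dropped: every \<open>x\<close> can be corrected by an element of
  \<open>A\<close> so as to normalize \<open>P\<close>.
\<close>
lemma (in group) frattini_argument:
  assumes fin: "finite (carrier G)" and p: "prime p"
    and P: "subgroup P G" "card P = p ^ k" and index: "\<not> p dvd card (rcosets P)"
    and A: "A \<lhd> G" and comm: "\<And>x y. \<lbrakk>x \<in> carrier G; y \<in> carrier G\<rbrakk> \<Longrightarrow> x \<otimes> y \<otimes> inv x \<otimes> inv y \<in> A"
    and x: "x \<in> carrier G"
  shows "\<exists>a\<in>A. \<forall>y\<in>P. (a \<otimes> x) \<otimes> y \<otimes> inv (a \<otimes> x) \<in> P"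
proof -
  let ?B = "A <#> P" 
  let ?GB = "G\<lparr>carrier := ?B\<rparr>"
  let ?Q = "x <# P #> inv x"
  have AG: "subgroup A G" using A by (rule normal_imp_subgroup)
  have in_A: "a \<in> carrier G" if "a \<in> A" for a using AG that by (rule subgroup.mem_carrier)
  have in_P: "y \<in> carrier G" if "y \<in> P" for y using P(1) that by (rule subgroup.mem_carrier)
  have B: "subgroup ?B G" using A P(1) by (rule mult_norm_subgroup)
  interpret GB: group ?GB using B by (rule subgroup_imp_group)
  have PB: "P \<subseteq> ?B"
    using subgroup.one_closed[OF AG] in_P by (force simp: set_mult_def)
  have "?Q \<subseteq> ?B"
  proof
    fix z assume "z \<in> ?Q"
    then obtain y where y: "y \<in> P" "z = x \<otimes> y \<otimes> inv x"
      by (auto simp: l_coset_def r_coset_def)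
    have "x \<otimes> y \<otimes> inv x \<otimes> inv y \<otimes> y \<in> ?B"
      using comm[OF x in_P[OF y(1)]] y(1) by (auto simp: set_mult_def)
    then show "z \<in> ?B" using x in_P[OF y(1)] y(2) by (simp add: m_assoc)
  qed
  moreover have Q: "subgroup ?Q G" using subgroup_conjugation_is_surj2[OF x P(1)] .
  ultimately have QB: "subgroup ?Q ?GB" using B by (simp add: subgroup_incl)
  have "card ?Q = card P"
  proof -
    have "?Q = (\<lambda>y. x \<otimes> y \<otimes> inv x) ` P" by (auto simp: l_coset_def r_coset_def)
    moreover have "inj_on (\<lambda>y. x \<otimes> y \<otimes> inv x) P"
      using x in_P by (intro inj_onI) (metis conjugation_is_inj)
    ultimately show ?thesis by (simp add: card_image)
  qed
  have PGB: "subgroup P ?GB" using P(1) B PB by (simp add: subgroup_incl)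
  have "card (rcosets\<^bsub>?GB\<^esub> P) dvd card (rcosets P)"
  proof -
    have "(card (rcosets\<^bsub>?GB\<^esub> P) * card (rcosets ?B)) * card P = card (rcosets P) * card P"
    proof -
      have "card (rcosets\<^bsub>?GB\<^esub> P) * card P = card ?B"
        using GB.lagrange[OF PGB] by (simp add: order_def)
      then have "(card (rcosets\<^bsub>?GB\<^esub> P) * card (rcosets ?B)) * card P = card (rcosets ?B) * card ?B"
        by (metis mult.assoc mult.commute)
      then show ?thesis using lagrange[OF P(1)] lagrange[OF B] by simp
    qed
    moreover have "card P \<noteq> 0" using P(2) p by simp
    ultimately have "card (rcosets P) = card (rcosets\<^bsub>?GB\<^esub> P) * card (rcosets ?B)" by simp
    then show ?thesis by simp
  qed
  then have "\<not> p dvd card (rcosets\<^bsub>?GB\<^esub> P)" using index dvd_trans by blast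
  moreover have "finite (carrier ?GB)"
    using finite_subset[OF subgroup.subset[OF B] fin] by simp
  ultimately obtain b where b: "b \<in> ?B"
    "\<And>q. q \<in> ?Q \<Longrightarrow> b \<otimes> q \<otimes> inv\<^bsub>?GB\<^esub> b \<in> P"
    using GB.p_subgroup_conjugate_into_sylow[OF _ p PGB _ QB, of k] P(2) \<open>card ?Q = card P\<close> by auto
  have "?B = P <#> A" using commut_normal[OF P(1) A] by simp
  then obtain y a where ya: "y \<in> P" "a \<in> A" "b = y \<otimes> a" using b(1) by (auto simp: set_mult_def)
  have "(a \<otimes> x) \<otimes> z \<otimes> inv (a \<otimes> x) \<in> P" if z: "z \<in> P" for z
  proof -
    have "x \<otimes> z \<otimes> inv x \<in> ?Q" using z by (auto simp: l_coset_def r_coset_def)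
    then have "b \<otimes> (x \<otimes> z \<otimes> inv x) \<otimes> inv b \<in> P"
      using b m_inv_consistent[OF B b(1)] by metis
    then have "inv y \<otimes> (b \<otimes> (x \<otimes> z \<otimes> inv x) \<otimes> inv b) \<otimes> y \<in> P"
      using ya(1) P(1) by (simp add: subgroup.m_closed subgroup.m_inv_closed)
    also have "inv y \<otimes> (b \<otimes> (x \<otimes> z \<otimes> inv x) \<otimes> inv b) \<otimes> y = (a \<otimes> x) \<otimes> z \<otimes> inv (a \<otimes> x)"
      using x in_P[OF ya(1)] in_A[OF ya(2)] in_P[OF z]
      by (simp add: ya(3) m_assoc inv_mult_group inv_mult_cancel_left)
    finally show ?thesis .
  qed
  with ya(2) show ?thesis by blast
qed

text \<open>
  By Frattini's argument with \<open>A\<close> the kernel of \<open>d\<close>, the normalizer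
  of \<open>P\<close> has the same image under \<open>d\<close> as the whole group.
\<close>
lemma (in group) sylow_normal_if_no_proper_subgroup_onto:
  assumes fin: "finite (carrier G)" and D: "comm_group D" and d: "d \<in> hom G D"
    and minimal: "\<And>K. \<lbrakk>subgroup K G; d ` K = d ` carrier G\<rbrakk> \<Longrightarrow> K = carrier G"
    and p: "prime p"
    and P: "subgroup P G" "card P = p ^ k" and index: "\<not> p dvd card (rcosets P)"
  shows "P \<lhd> G"
proof -
  interpret D: comm_group D by fact
  interpret d: group_hom G D d using d by unfold_locales
  let ?N = "{x \<in> carrier G. \<forall>y\<in>P. x \<otimes> y \<otimes> inv x \<in> P}"
  let ?A = "kernel G D d"
  have A: "?A \<lhd> G" by (rule d.normal_kernel)
  have comm: "x \<otimes> y \<otimes> inv x \<otimes> inv y \<in> ?A" if "x \<in> carrier G" "y \<in> carrier G" for x y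
  proof -
    have "d x \<otimes>\<^bsub>D\<^esub> d y \<otimes>\<^bsub>D\<^esub> inv\<^bsub>D\<^esub> d x \<otimes>\<^bsub>D\<^esub> inv\<^bsub>D\<^esub> d y = \<one>\<^bsub>D\<^esub>"
      using that by (metis D.inv_mult D.m_assoc D.m_comm D.r_inv D.m_closed D.inv_closed d.hom_closed)
    with that show ?thesis by (simp add: kernel_def)
  qed
  have "d ` ?N = d ` carrier G"
  proof (intro equalityI subsetI)
    fix z assume "z \<in> d ` carrier G"
    then obtain x where x: "x \<in> carrier G" "z = d x" by blast
    obtain a where a: "a \<in> ?A" "\<forall>y\<in>P. (a \<otimes> x) \<otimes> y \<otimes> inv (a \<otimes> x) \<in> P"
      using frattini_argument[OF fin p P index A comm x(1)] by blast
    then have "a \<otimes> x \<in> ?N" using x(1) by (simp add: kernel_def)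
    moreover have "d (a \<otimes> x) = z" using a(1) x by (simp add: kernel_def)
    ultimately show "z \<in> d ` ?N" by blast
  qed blast
  moreover have "subgroup ?N G"
    using self_conjugating_elements_subgroup[OF P(1)] finite_subset[OF subgroup.subset[OF P(1)] fin] by blast
  ultimately have "?N = carrier G" using minimal by blast
  then show ?thesis using P(1) by (auto intro!: normal_invI)
qed

lemma (in group) exists_sylow:
  assumes fin: "finite (carrier G)" and p: "prime p"
  obtains P :: "'a set" and k where "subgroup P G" "card P = p ^ k" "\<not> (p::nat) dvd card (rcosets P)"
proof -
  define k where "k = multiplicity p (order G)"
  have "order G \<noteq> 0" using fin order_gt_0_iff_finite by simp
  then obtain m where m: "order G = p ^ k * m" "\<not> p dvd m"
    unfolding k_def using p by (metis multiplicity_decompose' not_prime_unit)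
  obtain P where P: "subgroup P G" "card P = p ^ k"
    using sylow_thm[OF p is_group m(1) fin] by blast
  have "card (rcosets P) = m"
    using lagrange[OF P(1)] P(2) m(1) p by (simp add: mult.commute)
  with that P m(2) show thesis by blast
qed

lemma (in group) normal_sylow_contains_p_elements:
  assumes fin: "finite (carrier G)" and p: "prime p"
    and P: "P \<lhd> G" and index: "\<not> p dvd card (rcosets P)"
    and g: "g \<in> carrier G" "g [^] (p ^ i) = \<one>"
  shows "g \<in> P"
proof -
  have PG: "subgroup P G" using P by (rule normal_imp_subgroup)
  have "ord g dvd p ^ i" using g by (simp add: pow_eq_id)
  then obtain j where j: "ord g = p ^ j" using p divides_primepow_nat by blast
  have "card (generate G {g}) = p ^ j" using j g(1) by (simp add: generate_pow_card)
  then obtain x where x: "x \<in> carrier G" "\<forall>q\<in>generate G {g}. x \<otimes> q \<otimes> inv x \<in> P"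
    using p_subgroup_conjugate_into_sylow[OF fin p PG index generate_is_subgroup, of "{g}" j] g(1) by blast
  then have "x \<otimes> g \<otimes> inv x \<in> P" by (simp add: generate.incl)
  then have "inv x \<otimes> (x \<otimes> g \<otimes> inv x) \<otimes> inv (inv x) \<in> P"
    using normal.inv_op_closed2[OF P] x(1) by blast
  also have "inv x \<otimes> (x \<otimes> g \<otimes> inv x) \<otimes> inv (inv x) = g"
    using x(1) g(1) by (simp add: m_assoc inv_mult_cancel_left)
  finally show ?thesis .
qed

text \<open>
  The group is in fact nilpotent. The part of this used later is that the Sylow subgroups for
  \<open>p\<close> and \<open>q\<close> are normal with trivial intersection, so they commute
  elementwise.
\<close>
theorem (in group) commute_if_no_proper_subgroup_onto:
  assumes fin: "finite (carrier G)" and D: "comm_group D" and d: "d \<in> hom G D"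
    and minimal: "\<And>K. \<lbrakk>subgroup K G; d ` K = d ` carrier G\<rbrakk> \<Longrightarrow> K = carrier G"
    and pq: "prime (p::nat)" "prime (q::nat)" "p \<noteq> q"
    and g: "g \<in> carrier G" "g [^] (p ^ i) = \<one>"
    and h: "h \<in> carrier G" "h [^] (q ^ j) = \<one>"
  shows "g \<otimes> h = h \<otimes> g"
proof -
  obtain P k where P: "subgroup P G" "card P = p ^ k" "\<not> p dvd card (rcosets P)"
    using exists_sylow[OF fin pq(1)] by blast
  obtain Q l where Q: "subgroup Q G" "card Q = q ^ l" "\<not> q dvd card (rcosets Q)"
    using exists_sylow[OF fin pq(2)] by blast
  have PN: "P \<lhd> G" 
    using sylow_normal_if_no_proper_subgroup_onto[OF fin D d minimal pq(1) P] by blast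
  have QN: "Q \<lhd> G" 
    using sylow_normal_if_no_proper_subgroup_onto[OF fin D d minimal pq(2) Q] by blast
  have "coprime (card P) (card Q)"
    using pq by (simp add: P(2) Q(2) primes_coprime)
  moreover have PQ: "subgroup (P \<inter> Q) G"
    using P(1) Q(1) by (rule subgroups_Inter_pair)
  have "card (P \<inter> Q) dvd card R" if "subgroup R G" "P \<inter> Q \<subseteq> R" for R
    using group.lagrange[OF subgroup_imp_group[OF that(1)] subgroup_incl[OF PQ that]]
    by (metis dvd_triv_right order_def partial_object.select_convs(1) partial_object.surjective partial_object.update_convs(1))
  then have "card (P \<inter> Q) dvd card P" "card (P \<inter> Q) dvd card Q"
    using P(1) Q(1) by blast+
  ultimately have "card (P \<inter> Q) = 1" by (simp only: coprime_common_divisor_nat)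
  then have "P \<inter> Q \<subseteq> {\<one>}"
    using subgroup.one_closed[OF PQ] by (metis card_1_singletonE singletonD subset_refl)
  then show ?thesis
    using normal_imp_commuting[OF PN QN] 
      normal_sylow_contains_p_elements[OF fin pq(1) PN P(3) g]
      normal_sylow_contains_p_elements[OF fin pq(2) QN Q(3) h] by blast
qed

section \<open>Integers with only nonsquare odd powers\<close>

text \<open>
  For a primitive root \<open>c\<close>, raising \<open>c ^ m = a\<^sup>2\<close> to the power
  \<open>(q - 1) / 2\<close> gives \<open>1\<close> by Fermat, so \<open>q - 1\<close> divides
  \<open>m (q - 1) / 2\<close> and \<open>m\<close> is even.
\<close>
lemma odd_power_of_primitive_root_nonsquare:
  assumes q: "prime (q::nat)" "q \<noteq> 2"
  shows "\<exists>c::int. coprime c (int q) \<and> (\<forall>m a. odd m \<longrightarrow> \<not> [c ^ m = a\<^sup>2] (mod int q))"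
proof -
  have q2: "odd q" "q > 2"
    using q by (auto simp: prime_odd_nat prime_ge_2_nat order_le_neq_trans)
  obtain c where "residue_primroot q c"
    using prime_primitive_root_exists[OF _ q(1)] q2 by auto
  then have c: "coprime q c" "\<And>d. [c ^ d = 1] (mod q) \<longleftrightarrow> q - 1 dvd d"
    using q(1) ord_divides[of c _ q] by (auto simp: residue_primroot_def totient_prime)
  have "\<not> [int c ^ m = a\<^sup>2] (mod int q)" if m: "odd m" for m a
  proof
    assume sq: "[int c ^ m = a\<^sup>2] (mod int q)"
    have cop: "coprime (int c) (int q)" using c(1) by (simp add: coprime_commute)
    then have "coprime (a\<^sup>2) (int q)"
      using sq by (metis cong_imp_coprime coprime_power_left_iff cong_sym coprime_commute)
    then have a: "coprime a (int q)" by simp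
    have half: "2 * ((q - 1) div 2) = q - 1" using q2 by simp
    have "[(a\<^sup>2) ^ ((q - 1) div 2) = (int c ^ m) ^ ((q - 1) div 2)] (mod int q)"
      using sq by (intro cong_pow) (simp add: cong_sym)
    moreover have "(a\<^sup>2) ^ ((q - 1) div 2) = a ^ (q - 1)"
      by (simp only: power_mult[symmetric] half)
    moreover have "[a ^ (q - 1) = 1] (mod int q)"
    proof -
      define b where "b = nat (a mod int q)"
      have b: "[a = int b] (mod int q)" using q2 by (simp add: b_def cong_def)
      then have "coprime (int b) (int q)" using a cong_imp_coprime by blast
      then have "[b ^ (q - 1) = 1] (mod q)"
        using euler_theorem[of b q] q(1) by (simp add: totient_prime)
      then have "[int b ^ (q - 1) = 1] (mod int q)"
        by (metis cong_int_iff of_nat_1 of_nat_power)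
      then show ?thesis using cong_pow[OF b] cong_trans by blast
    qed
    ultimately have "[int c ^ (m * ((q - 1) div 2)) = 1] (mod int q)"
      by (metis cong_sym cong_trans power_mult)
    then have "[c ^ (m * ((q - 1) div 2)) = 1] (mod q)"
      by (metis cong_int_iff of_nat_1 of_nat_power)
    then have "q - 1 dvd m * ((q - 1) div 2)" using c(2) by simp
    then have "2 * ((q - 1) div 2) dvd m * ((q - 1) div 2)" using half by simp
    moreover have "(q - 1) div 2 > 0" using q2 by auto
    ultimately have "2 dvd m" by (metis dvd_mult_cancel2 nat_mult_dvd_cancel_disj mult.commute neq0_conv)
    with m show False by simp
  qed
  moreover have "coprime (int c) (int q)" using c(1) by (simp add: coprime_commute)
  ultimately show ?thesis by blast
qed

text \<open>
  By the Chinese remainder theorem, the integer with nonsquare odd powers modulo \<open>q\<close> can be chosen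
  congruent to \<open>1\<close> modulo the other primes of \<open>S\<close>.
\<close>
lemma exists_unit_with_nonsquare_odd_powers:
  assumes S: "finite S" "\<forall>p\<in>S. prime p" and q: "q \<in> S" "q \<noteq> 2"
  shows "\<exists>u::int. (\<forall>p\<in>S. coprime u (int p)) \<and> (\<forall>m a. odd m \<longrightarrow> \<not> [u ^ m = a\<^sup>2] (mod int q))"
proof -
  obtain c :: int where c: "coprime c (int q)" "\<And>m a. odd m \<Longrightarrow> \<not> [c ^ m = a\<^sup>2] (mod int q)"
    using odd_power_of_primitive_root_nonsquare[of q] S(2) q by blast
  have "coprime (int q) (\<Prod>p\<in>S - {q}. int p)"
    using S(2) q(1) by (intro prod_coprime_right) (auto intro!: primes_coprime)
  then obtain u where u: "[u = c] (mod int q)" "[u = 1] (mod (\<Prod>p\<in>S - {q}. int p))"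
    using binary_chinese_remainder_int by blast
  have "coprime u (int p)" if p: "p \<in> S" for p
  proof (cases "p = q")
    case True
    then show ?thesis using u(1) c(1) cong_imp_coprime cong_sym by blast
  next
    case False
    then have "int p dvd (\<Prod>p\<in>S - {q}. int p)" using p S(1) by (intro dvd_prodI) auto
    then have "[u = 1] (mod int p)" using u(2) cong_dvd_modulus by blast
    then show ?thesis using cong_imp_coprime cong_sym coprime_1_left by blast
  qed
  moreover have "\<not> [u ^ m = a\<^sup>2] (mod int q)" if "odd m" for m a
    using c(2)[OF that, of a] cong_pow[OF u(1), of m] cong_sym cong_trans by blast
  ultimately show ?thesis by blast
qed

section \<open>Residue classes of integers\<close>

lemma carrier_ZFact: "carrier (ZFact k) = range (ZMod k)"
  by (auto simp: ZFact_defs A_RCOSETS_def' ZMod_def)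

lemma ZMod_in_ZFact [simp, intro]: "ZMod k a \<in> carrier (ZFact k)"
  by (simp add: carrier_ZFact)

lemma mem_ZMod: "x \<in> ZMod k a \<longleftrightarrow> [x = a] (mod k)"
  by (auto simp: ZMod_def a_r_coset_def' int_Idl cong_iff_dvd_diff dvd_def algebra_simps)

lemma ZMod_eq_iff: "ZMod k a = ZMod k b \<longleftrightarrow> [a = b] (mod k)"
  by (simp add: ZMod_eq_mod cong_def)

lemma ZMod_mult: "ZMod k a \<otimes>\<^bsub>ZFact k\<^esub> ZMod k b = ZMod k (a * b)"
  by (simp add: ZFact_defs ZMod_def ideal.rcoset_mult_add[OF int.genideal_ideal])

lemma ZMod_add: "ZMod k a \<oplus>\<^bsub>ZFact k\<^esub> ZMod k b = ZMod k (a + b)"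
  by (simp add: ZFact_defs ZMod_def abelian_subgroup.a_rcos_sum[OF abelian_subgroupI3] ideal.axioms[OF int.genideal_ideal] int.abelian_group_axioms)

lemma ZMod_one: "\<one>\<^bsub>ZFact k\<^esub> = ZMod k 1"
  by (simp add: ZFact_defs ZMod_def)

lemma ZMod_zero: "\<zero>\<^bsub>ZFact k\<^esub> = ZMod k 0"
  by (simp add: ZFact_defs ZMod_def a_r_coset_def')

lemma ZMod_minus: "\<ominus>\<^bsub>ZFact k\<^esub> ZMod k a = ZMod k (- a)"
proof -
  interpret cring "ZFact k" by (rule ZFact_is_cring)
  show ?thesis by (rule minus_equality) (simp_all add: ZMod_add ZMod_zero)
qed

lemma ZMod_subset_iff: "l dvd k \<Longrightarrow> ZMod k a \<subseteq> ZMod l b \<longleftrightarrow> [a = b] (mod l)"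
  by (auto simp: mem_ZMod subset_iff intro: cong_trans cong_dvd_modulus)

lemma finite_ZFact: "k > 0 \<Longrightarrow> finite (carrier (ZFact k))"
proof -
  assume k: "k > 0"
  have "carrier (ZFact k) \<subseteq> ZMod k ` {0..<k}"
  proof
    fix x assume "x \<in> carrier (ZFact k)"
    then obtain a where "x = ZMod k a" by (auto simp: carrier_ZFact)
    then have "x = ZMod k (a mod k)" by (simp add: ZMod_eq_iff)
    moreover have "a mod k \<in> {0..<k}" using k by simp
    ultimately show "x \<in> ZMod k ` {0..<k}" by blast
  qed
  then show ?thesis by (rule finite_subset) simp
qed

section \<open>The ring \<open>\<int>\<^sub>S\<close>\<close>

lemma Z_S_simps:
  "x \<otimes>\<^bsub>Z_S S\<^esub> y = (\<lambda>n\<in>S_numbers S. x n \<otimes>\<^bsub>ZFact (int n)\<^esub> y n)"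
  "x \<oplus>\<^bsub>Z_S S\<^esub> y = (\<lambda>n\<in>S_numbers S. x n \<oplus>\<^bsub>ZFact (int n)\<^esub> y n)"
  "\<one>\<^bsub>Z_S S\<^esub> = (\<lambda>n\<in>S_numbers S. \<one>\<^bsub>ZFact (int n)\<^esub>)"
  "\<zero>\<^bsub>Z_S S\<^esub> = (\<lambda>n\<in>S_numbers S. \<zero>\<^bsub>ZFact (int n)\<^esub>)"
  by (simp_all add: Z_S_def)

lemma Z_S_carrierI:
  assumes "\<And>n m. \<lbrakk>n \<in> S_numbers S; m \<in> S_numbers S; m dvd n\<rbrakk> \<Longrightarrow> [f n = f m] (mod int m)"
  shows "(\<lambda>n\<in>S_numbers S. ZMod (int n) (f n)) \<in> carrier (Z_S S)"
  using assms by (auto simp: Z_S_def ZMod_subset_iff)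

text \<open>
  Elements of the inverse limit are handled through a family of integer representatives, one
  for each modulus.
\<close>
lemma Z_S_carrierE:
  assumes "x \<in> carrier (Z_S S)"
  obtains f where "x = (\<lambda>n\<in>S_numbers S. ZMod (int n) (f n))"
    and "\<And>n m. \<lbrakk>n \<in> S_numbers S; m \<in> S_numbers S; m dvd n\<rbrakk> \<Longrightarrow> [f n = f m] (mod int m)"
proof -
  have "\<forall>n\<in>S_numbers S. \<exists>a. x n = ZMod (int n) a"
  proof
    fix n assume "n \<in> S_numbers S"
    then have "x n \<in> carrier (ZFact (int n))" using assms by (auto simp: Z_S_def)
    then show "\<exists>a. x n = ZMod (int n) a" by (auto simp: carrier_ZFact)
  qed
  then obtain f where f: "\<And>n. n \<in> S_numbers S \<Longrightarrow> x n = ZMod (int n) (f n)" by metis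
  moreover have "x \<in> extensional (S_numbers S)"
    using assms by (simp add: Z_S_def PiE_def)
  ultimately have x: "x = (\<lambda>n\<in>S_numbers S. ZMod (int n) (f n))" by (auto intro!: extensionalityI)
  show thesis
  proof (rule that[OF x])
    fix n m assume nm: "n \<in> S_numbers S" "m \<in> S_numbers S" "m dvd n"
    then have "x n \<subseteq> x m" using assms by (auto simp: Z_S_def)
    with nm show "[f n = f m] (mod int m)" by (simp add: f ZMod_subset_iff)
  qed
qed

lemma Z_S_eqI:
  assumes "x \<in> carrier (Z_S S)" "y \<in> carrier (Z_S S)" "\<And>n. n \<in> S_numbers S \<Longrightarrow> x n = y n"
  shows "x = y"
  using assms by (auto simp: Z_S_def intro: PiE_ext)

lemma Z_S_is_cring: "cring (Z_S S)"
proof -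
  note ops = Z_S_simps ZMod_mult ZMod_add ZMod_one ZMod_zero
  have one: "\<one>\<^bsub>Z_S S\<^esub> \<in> carrier (Z_S S)" 
    using Z_S_carrierI[of S "\<lambda>_. 1"] by (simp add: ops)
  have zero: "\<zero>\<^bsub>Z_S S\<^esub> \<in> carrier (Z_S S)" 
    using Z_S_carrierI[of S "\<lambda>_. 0"] by (simp add: ops)
  have mult: "x \<otimes>\<^bsub>Z_S S\<^esub> y \<in> carrier (Z_S S)"
    if xy: "x \<in> carrier (Z_S S)" "y \<in> carrier (Z_S S)" for x y
  proof -
    from xy(1) obtain f where f: "x = (\<lambda>n\<in>S_numbers S. ZMod (int n) (f n))"
      "\<And>n m. \<lbrakk>n \<in> S_numbers S; m \<in> S_numbers S; m dvd n\<rbrakk> \<Longrightarrow> [f n = f m] (mod int m)"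
      by (rule Z_S_carrierE) blast
    from xy(2) obtain g where g: "y = (\<lambda>n\<in>S_numbers S. ZMod (int n) (g n))"
      "\<And>n m. \<lbrakk>n \<in> S_numbers S; m \<in> S_numbers S; m dvd n\<rbrakk> \<Longrightarrow> [g n = g m] (mod int m)"
      by (rule Z_S_carrierE) blast
    have "x \<otimes>\<^bsub>Z_S S\<^esub> y = (\<lambda>n\<in>S_numbers S. ZMod (int n) (f n * g n))"
      unfolding f(1) g(1) by (auto simp: ops intro!: restrict_ext)
    then show ?thesis using Z_S_carrierI[of S "\<lambda>n. f n * g n"] cong_mult[OF f(2) g(2)] by simp
  qed
  have add: "x \<oplus>\<^bsub>Z_S S\<^esub> y \<in> carrier (Z_S S)"
    if xy: "x \<in> carrier (Z_S S)" "y \<in> carrier (Z_S S)" for x y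
  proof -
    from xy(1) obtain f where f: "x = (\<lambda>n\<in>S_numbers S. ZMod (int n) (f n))"
      "\<And>n m. \<lbrakk>n \<in> S_numbers S; m \<in> S_numbers S; m dvd n\<rbrakk> \<Longrightarrow> [f n = f m] (mod int m)"
      by (rule Z_S_carrierE) blast
    from xy(2) obtain g where g: "y = (\<lambda>n\<in>S_numbers S. ZMod (int n) (g n))"
      "\<And>n m. \<lbrakk>n \<in> S_numbers S; m \<in> S_numbers S; m dvd n\<rbrakk> \<Longrightarrow> [g n = g m] (mod int m)"
      by (rule Z_S_carrierE) blast
    have "x \<oplus>\<^bsub>Z_S S\<^esub> y = (\<lambda>n\<in>S_numbers S. ZMod (int n) (f n + g n))"
      unfolding f(1) g(1) by (auto simp: ops intro!: restrict_ext)
    then show ?thesis using Z_S_carrierI[of S "\<lambda>n. f n + g n"] cong_add[OF f(2) g(2)] by simp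
  qed
  have neg: "\<exists>y\<in>carrier (Z_S S). y \<oplus>\<^bsub>Z_S S\<^esub> x = \<zero>\<^bsub>Z_S S\<^esub>" 
    if x: "x \<in> carrier (Z_S S)" for x
  proof -
    from x obtain f where f: "x = (\<lambda>n\<in>S_numbers S. ZMod (int n) (f n))"
      "\<And>n m. \<lbrakk>n \<in> S_numbers S; m \<in> S_numbers S; m dvd n\<rbrakk> \<Longrightarrow> [f n = f m] (mod int m)"
      by (rule Z_S_carrierE) blast
    let ?y = "\<lambda>n\<in>S_numbers S. ZMod (int n) (- f n)"
    have "?y \<oplus>\<^bsub>Z_S S\<^esub> x = \<zero>\<^bsub>Z_S S\<^esub>" 
      unfolding f(1) by (auto simp: ops intro!: restrict_ext)
    moreover have "?y \<in> carrier (Z_S S)"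
      by (rule Z_S_carrierI) (simp add: f(2) cong_minus_minus_iff)
    ultimately show ?thesis by blast
  qed
  have at: "x n \<in> carrier (ZFact (int n))" if "x \<in> carrier (Z_S S)" "n \<in> S_numbers S" for x n
    using that by (auto simp: Z_S_def)
  note R = ZFact_is_cring
  have ring_at: "ring (ZFact (int n))" for n using R by (rule cring.axioms)
  note rules = ring.ring_simprules[OF ring_at] cring.cring_simprules[OF R] monoid.r_one[OF ring.is_monoid[OF ring_at]]
  show ?thesis
  proof (rule cringI)
    show "abelian_group (Z_S S)"
    proof (rule abelian_groupI)
      fix x y z assume xyz: "x \<in> carrier (Z_S S)" "y \<in> carrier (Z_S S)" "z \<in> carrier (Z_S S)"
      show "x \<oplus>\<^bsub>Z_S S\<^esub> y \<oplus>\<^bsub>Z_S S\<^esub> z = x \<oplus>\<^bsub>Z_S S\<^esub> (y \<oplus>\<^bsub>Z_S S\<^esub> z)"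
        by (rule Z_S_eqI[where S = S], simp add: add xyz, simp add: add xyz, simp add: Z_S_simps at xyz rules)
    next
      fix x y assume xyz: "x \<in> carrier (Z_S S)" "y \<in> carrier (Z_S S)"
      show "x \<oplus>\<^bsub>Z_S S\<^esub> y = y \<oplus>\<^bsub>Z_S S\<^esub> x"
        by (rule Z_S_eqI[where S = S], simp add: add xyz, simp add: add xyz, simp add: Z_S_simps at xyz rules)
    next
      fix x assume xyz: "x \<in> carrier (Z_S S)" 
      show "\<zero>\<^bsub>Z_S S\<^esub> \<oplus>\<^bsub>Z_S S\<^esub> x = x"
        by (rule Z_S_eqI[where S = S], simp add: add zero xyz, simp add: add zero xyz, simp add: Z_S_simps at xyz rules)
    qed (simp_all add: add zero neg)
    show "Group.comm_monoid (Z_S S)"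
    proof (rule comm_monoidI)
      fix x y z assume xyz: "x \<in> carrier (Z_S S)" "y \<in> carrier (Z_S S)" "z \<in> carrier (Z_S S)"
      show "x \<otimes>\<^bsub>Z_S S\<^esub> y \<otimes>\<^bsub>Z_S S\<^esub> z = x \<otimes>\<^bsub>Z_S S\<^esub> (y \<otimes>\<^bsub>Z_S S\<^esub> z)"
        by (rule Z_S_eqI[where S = S], simp add: mult xyz, simp add: mult xyz, simp add: Z_S_simps at xyz rules)
    next
      fix x y assume xyz: "x \<in> carrier (Z_S S)" "y \<in> carrier (Z_S S)"
      show "x \<otimes>\<^bsub>Z_S S\<^esub> y = y \<otimes>\<^bsub>Z_S S\<^esub> x"
        by (rule Z_S_eqI[where S = S], simp add: mult xyz, simp add: mult xyz, simp add: Z_S_simps at xyz rules)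
    next
      fix x assume xyz: "x \<in> carrier (Z_S S)" 
      show "\<one>\<^bsub>Z_S S\<^esub> \<otimes>\<^bsub>Z_S S\<^esub> x = x"
        by (rule Z_S_eqI[where S = S], simp add: mult one xyz, simp add: mult one xyz, simp add: Z_S_simps at xyz rules)
    qed (simp_all add: mult one)
    fix x y z assume xyz: "x \<in> carrier (Z_S S)" "y \<in> carrier (Z_S S)" "z \<in> carrier (Z_S S)"
    show "(x \<oplus>\<^bsub>Z_S S\<^esub> y) \<otimes>\<^bsub>Z_S S\<^esub> z = x \<otimes>\<^bsub>Z_S S\<^esub> z \<oplus>\<^bsub>Z_S S\<^esub> y \<otimes>\<^bsub>Z_S S\<^esub> z"
      by (rule Z_S_eqI[where S = S], simp add: mult add xyz, simp add: mult add xyz, simp add: Z_S_simps at xyz rules)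
  qed
qed

lemma Z_S_eval_hom: "n \<in> S_numbers S \<Longrightarrow> (\<lambda>x. x n) \<in> ring_hom (Z_S S) (ZFact (int n))"
  by (auto intro!: ring_hom_memI simp: Z_S_simps) (auto simp: Z_S_def)

lemma Z_S_eval_ring_hom_cring:
  "n \<in> S_numbers S \<Longrightarrow> ring_hom_cring (Z_S S) (ZFact (int n)) (\<lambda>x. x n)"
  by (simp add: ring_hom_cring_def ring_hom_cring_axioms_def Z_S_is_cring ZFact_is_cring Z_S_eval_hom)

definition Z_S_of_int :: "nat set \<Rightarrow> int \<Rightarrow> nat \<Rightarrow> int set" where
  "Z_S_of_int S a = (\<lambda>n\<in>S_numbers S. ZMod (int n) a)"

lemma Z_S_of_int_carrier: "Z_S_of_int S a \<in> carrier (Z_S S)"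
  unfolding Z_S_of_int_def by (rule Z_S_carrierI) simp

lemma Z_S_of_int_at: "n \<in> S_numbers S \<Longrightarrow> Z_S_of_int S a n = ZMod (int n) a"
  by (simp add: Z_S_of_int_def)

text \<open>
  Inverses modulo the various \<open>n\<close> are unique, hence compatible, so they assemble
  to an inverse in the limit.
\<close>
lemma Z_S_of_int_unit:
  assumes c: "\<And>p. p \<in> S \<Longrightarrow> coprime c (int p)"
  shows "Z_S_of_int S c \<in> Units (Z_S S)"
proof -
  interpret cring "Z_S S" by (rule Z_S_is_cring)
  have cop: "coprime c (int n)" if "n \<in> S_numbers S" for n
  proof -
    have n: "n > 0" "prime_factors n \<subseteq> S" using that by (auto simp: S_numbers_def)
    have "gcd (nat \<bar>c\<bar>) n = 1"
    proof (rule ccontr)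
      assume "gcd (nat \<bar>c\<bar>) n \<noteq> 1"
      then obtain p where p: "prime p" "p dvd gcd (nat \<bar>c\<bar>) n"
        using prime_factor_nat by blast
      then have "p dvd nat \<bar>c\<bar>" "p dvd n" by (metis gcd_dvd1 gcd_dvd2 dvd_trans)+
      then have "p \<in> prime_factors n" using n(1) p(1) by (simp add: in_prime_factors_iff)
      then have "coprime c (int p)" using n(2) c by blast
      moreover have "int p dvd c" using \<open>p dvd nat \<bar>c\<bar>\<close> by (simp add: nat_dvd_iff flip: int_dvd_int_iff)
      ultimately have "is_unit (int p)" by (simp add: coprime_absorb_right)
      then show False using p(1) by simp
    qed
    then have "gcd \<bar>c\<bar> (int n) = 1"
      by (metis abs_ge_zero gcd_int_int_eq int_nat_eq of_nat_1)
    then show ?thesis by (simp add: coprime_iff_gcd_eq_1)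
  qed
  have "\<forall>n\<in>S_numbers S. \<exists>d. [c * d = 1] (mod int n)"
    using cop cong_solve_coprime_int by blast
  then obtain d where d: "\<And>n. n \<in> S_numbers S \<Longrightarrow> [c * d n = 1] (mod int n)" by metis
  have "[d n = d m] (mod int m)" if nm: "n \<in> S_numbers S" "m \<in> S_numbers S" "m dvd n" for n m
  proof -
    have "[c * d n = 1] (mod int m)" using d[OF nm(1)] nm(3) cong_dvd_modulus by (metis of_nat_dvd_iff)
    then have "[c * d n = c * d m] (mod int m)" using d[OF nm(2)] cong_sym cong_trans by blast
    then show ?thesis using cop[OF nm(2)] by (simp add: cong_mult_lcancel)
  qed
  then have y: "(\<lambda>n\<in>S_numbers S. ZMod (int n) (d n)) \<in> carrier (Z_S S)" (is "?y \<in> _")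
    by (rule Z_S_carrierI)
  have "ZMod (int n) (c * d n) = ZMod (int n) 1" if "n \<in> S_numbers S" for n
    using d[OF that] by (simp add: ZMod_eq_iff)
  then have "Z_S_of_int S c \<otimes>\<^bsub>Z_S S\<^esub> ?y = \<one>\<^bsub>Z_S S\<^esub>"
    by (simp add: Z_S_simps ZMod_mult ZMod_one Z_S_of_int_def cong: restrict_cong)
  moreover from this have "?y \<otimes>\<^bsub>Z_S S\<^esub> Z_S_of_int S c = \<one>\<^bsub>Z_S S\<^esub>"
    using m_comm[OF Z_S_of_int_carrier y] by simp
  ultimately show ?thesis
    using Z_S_of_int_carrier[of S c] y unfolding Units_def by blast
qed

section \<open>Two by two matrices over a commutative ring\<close>

definition mat2 :: "'a \<Rightarrow> 'a \<Rightarrow> 'a \<Rightarrow> 'a \<Rightarrow> 'a^2^2" where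
  "mat2 a b c d = (\<chi> i j. if i = 1 then if j = 1 then a else b else if j = 1 then c else d)"

lemma mat2_nth [simp]:
  "mat2 a b c d $ 1 $ 1 = a" "mat2 a b c d $ 1 $ 2 = b"
  "mat2 a b c d $ 2 $ 1 = c" "mat2 a b c d $ 2 $ 2 = d"
  by (simp_all add: mat2_def)

lemma mat2_eqI:
  assumes "A $ 1 $ 1 = B $ 1 $ 1" "A $ 1 $ 2 = B $ 1 $ 2" "A $ 2 $ 1 = B $ 2 $ 1" "A $ 2 $ 2 = B $ 2 $ 2"
  shows "(A :: 'a^2^2) = B"
  using assms by (simp add: vec_eq_iff forall_2)

lemma mat2_eq_iff: "mat2 a b c d = mat2 a' b' c' d' \<longleftrightarrow> a = a' \<and> b = b' \<and> c = c' \<and> d = d'"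
proof
  assume eq: "mat2 a b c d = mat2 a' b' c' d'"
  show "a = a' \<and> b = b' \<and> c = c' \<and> d = d'"
    using arg_cong[OF eq, of "\<lambda>A. (A $ 1 $ 1, A $ 1 $ 2, A $ 2 $ 1, A $ 2 $ 2)"] by simp
qed simp

lemma Mat2_carrier_iff:
  "A \<in> carrier (Mat2 R) \<longleftrightarrow> A $ 1 $ 1 \<in> carrier R \<and> A $ 1 $ 2 \<in> carrier R \<and> A $ 2 $ 1 \<in> carrier R \<and> A $ 2 $ 2 \<in> carrier R"
  by (auto simp: Mat2_def forall_2)

lemma Mat2_mult_nth:
  "(A \<otimes>\<^bsub>Mat2 R\<^esub> B) $ i $ j = (A $ i $ 1 \<otimes>\<^bsub>R\<^esub> B $ 1 $ j) \<oplus>\<^bsub>R\<^esub> (A $ i $ 2 \<otimes>\<^bsub>R\<^esub> B $ 2 $ j)"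
  by (simp add: Mat2_def)

lemma Mat2_one: "\<one>\<^bsub>Mat2 R\<^esub> = mat2 \<one>\<^bsub>R\<^esub> \<zero>\<^bsub>R\<^esub> \<zero>\<^bsub>R\<^esub> \<one>\<^bsub>R\<^esub>"
  by (rule mat2_eqI) (simp_all add: Mat2_def)

lemma GL2_mult: "A \<otimes>\<^bsub>GL2 R\<^esub> B = A \<otimes>\<^bsub>Mat2 R\<^esub> B"
  by (simp add: GL2_def units_of_mult)

lemma GL2_one: "\<one>\<^bsub>GL2 R\<^esub> = mat2 \<one>\<^bsub>R\<^esub> \<zero>\<^bsub>R\<^esub> \<zero>\<^bsub>R\<^esub> \<one>\<^bsub>R\<^esub>"
  by (simp add: GL2_def units_of_one Mat2_one)

context cring
begin

lemma Mat2_monoid: "Group.monoid (Mat2 R)"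
proof (rule monoidI)
  fix A B C assume "A \<in> carrier (Mat2 R)" "B \<in> carrier (Mat2 R)" "C \<in> carrier (Mat2 R)"
  then show "A \<otimes>\<^bsub>Mat2 R\<^esub> B \<otimes>\<^bsub>Mat2 R\<^esub> C = A \<otimes>\<^bsub>Mat2 R\<^esub> (B \<otimes>\<^bsub>Mat2 R\<^esub> C)"
    by (intro mat2_eqI) (simp_all add: Mat2_carrier_iff Mat2_mult_nth l_distr r_distr m_assoc a_ac)
next
  fix A assume "A \<in> carrier (Mat2 R)"
  then show "\<one>\<^bsub>Mat2 R\<^esub> \<otimes>\<^bsub>Mat2 R\<^esub> A = A" "A \<otimes>\<^bsub>Mat2 R\<^esub> \<one>\<^bsub>Mat2 R\<^esub> = A"
    by (intro mat2_eqI; simp add: Mat2_carrier_iff Mat2_mult_nth Mat2_one)+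
qed (simp_all add: Mat2_carrier_iff Mat2_mult_nth Mat2_one)

lemma det2_closed: "A \<in> carrier (Mat2 R) \<Longrightarrow> det2 R A \<in> carrier R"
  by (simp add: det2_def Mat2_carrier_iff)

lemma det2_mult:
  assumes "A \<in> carrier (Mat2 R)" "B \<in> carrier (Mat2 R)"
  shows "det2 R (A \<otimes>\<^bsub>Mat2 R\<^esub> B) = det2 R A \<otimes> det2 R B"
proof -
  have "(a \<otimes> a' \<oplus> b \<otimes> c') \<otimes> (c \<otimes> b' \<oplus> d \<otimes> d') \<ominus> (a \<otimes> b' \<oplus> b \<otimes> d') \<otimes> (c \<otimes> a' \<oplus> d \<otimes> c')
      = (a \<otimes> d \<ominus> b \<otimes> c) \<otimes> (a' \<otimes> d' \<ominus> b' \<otimes> c')"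
    if "a \<in> carrier R" "b \<in> carrier R" "c \<in> carrier R" "d \<in> carrier R"
      "a' \<in> carrier R" "b' \<in> carrier R" "c' \<in> carrier R" "d' \<in> carrier R" for a b c d a' b' c' d'
    using that by algebra
  with assms show ?thesis by (simp add: det2_def Mat2_mult_nth Mat2_carrier_iff)
qed

lemma det2_one: "det2 R \<one>\<^bsub>Mat2 R\<^esub> = \<one>"
  by (simp add: det2_def Mat2_one minus_eq)

lemma GL2_group: "group (GL2 R)"
  unfolding GL2_def by (rule monoid.units_group[OF Mat2_monoid])

text \<open>
  One direction is multiplicativity of the determinant, the other the adjugate matrix.
\<close>
lemma GL2_carrier: "carrier (GL2 R) = {A \<in> carrier (Mat2 R). det2 R A \<in> Units R}"
proof (intro equalityI subsetI)
  fix A assume "A \<in> carrier (GL2 R)"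
  then have A: "A \<in> carrier (Mat2 R)"
    and "\<exists>B\<in>carrier (Mat2 R). B \<otimes>\<^bsub>Mat2 R\<^esub> A = \<one>\<^bsub>Mat2 R\<^esub> \<and> A \<otimes>\<^bsub>Mat2 R\<^esub> B = \<one>\<^bsub>Mat2 R\<^esub>"
    by (auto simp: GL2_def units_of_carrier Units_def)
  then obtain B where B: "B \<in> carrier (Mat2 R)" "B \<otimes>\<^bsub>Mat2 R\<^esub> A = \<one>\<^bsub>Mat2 R\<^esub>" "A \<otimes>\<^bsub>Mat2 R\<^esub> B = \<one>\<^bsub>Mat2 R\<^esub>"
    by blast
  have "det2 R B \<otimes> det2 R A = \<one>" "det2 R A \<otimes> det2 R B = \<one>"
    using det2_mult[OF B(1) A] det2_mult[OF A B(1)] by (simp_all add: B det2_one)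
  with A B(1) show "A \<in> {A \<in> carrier (Mat2 R). det2 R A \<in> Units R}"
    by (auto simp: Units_def det2_closed)
next
  fix A assume "A \<in> {A \<in> carrier (Mat2 R). det2 R A \<in> Units R}"
  then have A: "A \<in> carrier (Mat2 R)" and det: "det2 R A \<in> Units R" by auto
  let ?u = "inv (det2 R A)"
  let ?B = "mat2 (?u \<otimes> A $ 2 $ 2) (\<ominus> (?u \<otimes> A $ 1 $ 2)) (\<ominus> (?u \<otimes> A $ 2 $ 1)) (?u \<otimes> A $ 1 $ 1)"
  have u: "?u \<in> carrier R" "?u \<otimes> det2 R A = \<one>" using det by simp_all
  have B: "?B \<in> carrier (Mat2 R)" using A u by (simp add: Mat2_carrier_iff)
  have ent: "u \<otimes> d \<otimes> a \<oplus> \<ominus> (u \<otimes> b) \<otimes> c = u \<otimes> (a \<otimes> d \<ominus> b \<otimes> c)"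
    "u \<otimes> d \<otimes> b \<oplus> \<ominus> (u \<otimes> b) \<otimes> d = \<zero>"
    "\<ominus> (u \<otimes> c) \<otimes> a \<oplus> u \<otimes> a \<otimes> c = \<zero>"
    "\<ominus> (u \<otimes> c) \<otimes> b \<oplus> u \<otimes> a \<otimes> d = u \<otimes> (a \<otimes> d \<ominus> b \<otimes> c)"
    "a \<otimes> (u \<otimes> d) \<oplus> b \<otimes> (\<ominus> (u \<otimes> c)) = u \<otimes> (a \<otimes> d \<ominus> b \<otimes> c)"
    "a \<otimes> (\<ominus> (u \<otimes> b)) \<oplus> b \<otimes> (u \<otimes> a) = \<zero>"
    "c \<otimes> (u \<otimes> d) \<oplus> d \<otimes> (\<ominus> (u \<otimes> c)) = \<zero>"
    "c \<otimes> (\<ominus> (u \<otimes> b)) \<oplus> d \<otimes> (u \<otimes> a) = u \<otimes> (a \<otimes> d \<ominus> b \<otimes> c)"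
    if "u \<in> carrier R" "a \<in> carrier R" "b \<in> carrier R" "c \<in> carrier R" "d \<in> carrier R" for u a b c d
    using that by algebra+
  have "A $ 1 $ 1 \<in> carrier R" "A $ 1 $ 2 \<in> carrier R" "A $ 2 $ 1 \<in> carrier R" "A $ 2 $ 2 \<in> carrier R"
    using A by (simp_all add: Mat2_carrier_iff)
  note ent_A = ent[OF u(1) this, folded det2_def, unfolded u(2)]
  have "?B \<otimes>\<^bsub>Mat2 R\<^esub> A = \<one>\<^bsub>Mat2 R\<^esub>" "A \<otimes>\<^bsub>Mat2 R\<^esub> ?B = \<one>\<^bsub>Mat2 R\<^esub>"
    by (rule mat2_eqI; simp only: Mat2_mult_nth Mat2_one ent_A mat2_nth)+
  with A B show "A \<in> carrier (GL2 R)"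
    by (auto simp: GL2_def units_of_carrier Units_def)
qed

lemma det2_hom: "det2 R \<in> hom (GL2 R) (units_of R)"
  by (rule homI) (simp_all add: GL2_carrier units_of_carrier units_of_mult GL2_mult det2_mult)

end

lemma finite_GL2:
  assumes "cring R" and "finite (carrier R)"
  shows "finite (carrier (GL2 R))"
proof -
  have "carrier (GL2 R) \<subseteq>
      (\<lambda>(a, b, c, d). mat2 a b c d) ` (carrier R \<times> carrier R \<times> carrier R \<times> carrier R)"
  proof
    fix A assume "A \<in> carrier (GL2 R)"
    then have "A \<in> carrier (Mat2 R)" by (simp add: cring.GL2_carrier[OF assms(1)])
    moreover have "A = mat2 (A $ 1 $ 1) (A $ 1 $ 2) (A $ 2 $ 1) (A $ 2 $ 2)"
      by (rule mat2_eqI) simp_all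
    ultimately show "A \<in> (\<lambda>(a, b, c, d). mat2 a b c d) ` (carrier R \<times> carrier R \<times> carrier R \<times> carrier R)"
      by (intro image_eqI[where x = "(A $ 1 $ 1, A $ 1 $ 2, A $ 2 $ 1, A $ 2 $ 2)"])
         (simp_all add: Mat2_carrier_iff)
  qed
  then show ?thesis by (rule finite_subset) (simp add: assms(2))
qed

section \<open>Reduction modulo an integer\<close>

lemma reduction_nth: "reduction n A $ i $ j = (A $ i $ j) n"
  by (simp add: reduction_def)

lemma reduction_mat2: "reduction n (mat2 a b c d) = mat2 (a n) (b n) (c n) (d n)"
  by (rule mat2_eqI) (simp_all add: reduction_nth)

lemma det2_reduction:
  assumes "n \<in> S_numbers S" and "A \<in> carrier (Mat2 (Z_S S))"
  shows "det2 (ZFact (int n)) (reduction n A) = det2 (Z_S S) A n"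
proof -
  interpret ring_hom_cring "Z_S S" "ZFact (int n)" "\<lambda>x. x n"
    using assms(1) by (rule Z_S_eval_ring_hom_cring)
  show ?thesis
    using assms(2) by (simp add: det2_def reduction_nth Mat2_carrier_iff R.minus_eq S.minus_eq)
qed

lemma reduction_hom:
  assumes n: "n \<in> S_numbers S"
  shows "reduction n \<in> hom (GL2 (Z_S S)) (GL2 (ZFact (int n)))"
proof (rule homI)
  interpret ring_hom_cring "Z_S S" "ZFact (int n)" "\<lambda>x. x n"
    using n by (rule Z_S_eval_ring_hom_cring)
  fix A B assume A: "A \<in> carrier (GL2 (Z_S S))" and B: "B \<in> carrier (GL2 (Z_S S))"
  show "reduction n (A \<otimes>\<^bsub>GL2 (Z_S S)\<^esub> B) = reduction n A \<otimes>\<^bsub>GL2 (ZFact (int n))\<^esub> reduction n B"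
    using A B by (intro mat2_eqI) (simp_all add: GL2_mult Mat2_mult_nth reduction_nth R.GL2_carrier Mat2_carrier_iff)
next
  interpret ring_hom_cring "Z_S S" "ZFact (int n)" "\<lambda>x. x n"
    using n by (rule Z_S_eval_ring_hom_cring)
  fix A assume "A \<in> carrier (GL2 (Z_S S))"
  then have A: "A \<in> carrier (Mat2 (Z_S S))" and u: "det2 (Z_S S) A \<in> Units (Z_S S)"
    by (auto simp: R.GL2_carrier)
  let ?v = "inv\<^bsub>Z_S S\<^esub> det2 (Z_S S) A"
  have v: "?v \<in> carrier (Z_S S)" using u by simp
  have "det2 (Z_S S) A n \<otimes>\<^bsub>ZFact (int n)\<^esub> ?v n = \<one>\<^bsub>ZFact (int n)\<^esub>"
    using hom_mult[OF R.Units_closed[OF u] v] R.Units_r_inv[OF u] by simp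
  moreover have "det2 (Z_S S) A n \<in> carrier (ZFact (int n))" "?v n \<in> carrier (ZFact (int n))"
    using v R.Units_closed[OF u] by simp_all
  moreover from calculation have "?v n \<otimes>\<^bsub>ZFact (int n)\<^esub> det2 (Z_S S) A n = \<one>\<^bsub>ZFact (int n)\<^esub>"
    using S.m_comm[of "det2 (Z_S S) A n" "?v n"] by simp
  ultimately have "det2 (Z_S S) A n \<in> Units (ZFact (int n))"
    unfolding Units_def by blast
  moreover have "reduction n A \<in> carrier (Mat2 (ZFact (int n)))"
    using A by (simp add: Mat2_carrier_iff reduction_nth)
  ultimately show "reduction n A \<in> carrier (GL2 (ZFact (int n)))"
    by (simp add: S.GL2_carrier det2_reduction[OF n A])
qed

lemma reduction_eq_dvd:
  assumes n: "n \<in> S_numbers S" "m \<in> S_numbers S" "m dvd n"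
    and A: "A \<in> carrier (GL2 (Z_S S))" and B: "B \<in> carrier (GL2 (Z_S S))"
    and eq: "reduction n A = reduction n B"
  shows "reduction m A = reduction m B"
proof -
  have eq': "x m = y m" if xy: "x \<in> carrier (Z_S S)" "y \<in> carrier (Z_S S)" "x n = y n" for x y
  proof -
    from xy(1) obtain f where f: "x = (\<lambda>n\<in>S_numbers S. ZMod (int n) (f n))"
      "\<And>n m. \<lbrakk>n \<in> S_numbers S; m \<in> S_numbers S; m dvd n\<rbrakk> \<Longrightarrow> [f n = f m] (mod int m)"
      by (rule Z_S_carrierE) blast
    from xy(2) obtain g where g: "y = (\<lambda>n\<in>S_numbers S. ZMod (int n) (g n))"
      "\<And>n m. \<lbrakk>n \<in> S_numbers S; m \<in> S_numbers S; m dvd n\<rbrakk> \<Longrightarrow> [g n = g m] (mod int m)"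
      by (rule Z_S_carrierE) blast
    have "[f n = g n] (mod int n)" using xy(3) n(1) by (simp add: f(1) g(1) ZMod_eq_iff)
    then have "[f n = g n] (mod int m)" using n(3) by (meson cong_dvd_modulus of_nat_dvd_iff)
    then have "[f m = g m] (mod int m)" using f(2)[OF n] g(2)[OF n] by (meson cong_sym cong_trans)
    then show ?thesis using n(2) by (simp add: f(1) g(1) ZMod_eq_iff)
  qed
  have "\<And>i j. (A $ i $ j) n = (B $ i $ j) n" using eq by (metis reduction_nth)
  moreover have "\<And>i j. A $ i $ j \<in> carrier (Z_S S)" "\<And>i j. B $ i $ j \<in> carrier (Z_S S)"
    using A B by (auto simp: GL2_def units_of_carrier Units_def Mat2_def)
  ultimately have "\<And>i j. (A $ i $ j) m = (B $ i $ j) m"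
    using eq' by blast
  then show ?thesis
    by (simp add: reduction_def)
qed

section \<open>Minimal groups and their finite quotients\<close>

text \<open>
  Reduction modulo \<open>N\<close> determines reduction modulo its divisor \<open>n\<close>.
\<close>
lemma level_multiple:
  assumes level: "H = {A \<in> carrier (GL2 (Z_S S)). reduction n A \<in> reduction n ` H}"
    and n: "n \<in> S_numbers S" "N \<in> S_numbers S" "n dvd N"
  shows "H = {A \<in> carrier (GL2 (Z_S S)). reduction N A \<in> reduction N ` H}"
proof -
  have HG: "A \<in> carrier (GL2 (Z_S S))" if "A \<in> H" for A
    using that by (subst (asm) level) simp
  have "A \<in> H" if "A \<in> carrier (GL2 (Z_S S))" "B \<in> H" "reduction N A = reduction N B" for A B
  proof -
    have "reduction n A = reduction n B"
      using reduction_eq_dvd[OF n(2,1,3) that(1) HG[OF that(2)] that(3)] .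
    then show ?thesis using that(1,2) by (subst level) blast
  qed
  then show ?thesis using HG by blast
qed

lemma closedin_reduction_preimage:
  assumes N: "N \<in> S_numbers S" and H: "H \<subseteq> carrier (GL2 (Z_S S))"
  shows "closedin (subtopology (GL2_topology S) H) {A \<in> H. reduction N A \<in> K}"
proof -
  let ?G = "carrier (GL2 (Z_S S))" and ?F = "\<lambda>n. carrier (GL2 (ZFact (int n)))"
  let ?P = "product_topology (\<lambda>n. discrete_topology (?F n)) (S_numbers S)"
  let ?f = "\<lambda>A. \<lambda>n\<in>S_numbers S. reduction n A"
  have red: "reduction n A \<in> ?F n" if "A \<in> ?G" "n \<in> S_numbers S" for n A
    using hom_in_carrier[OF reduction_hom[OF that(2)] that(1)] .
  have space: "topspace (GL2_topology S) = ?G"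
    using red by (auto simp: GL2_topology_def topspace_pullback_topology)
  have "continuous_map (GL2_topology S) (discrete_topology (?F N)) ((\<lambda>x. x N) \<circ> ?f)"
    unfolding GL2_topology_def
    by (rule continuous_map_pullback, rule continuous_map_product_projection, rule N)
  then have "closedin (GL2_topology S) {A \<in> topspace (GL2_topology S). ((\<lambda>x. x N) \<circ> ?f) A \<in> K \<inter> ?F N}"
    by (rule closedin_continuous_map_preimage) simp
  also have "{A \<in> topspace (GL2_topology S). ((\<lambda>x. x N) \<circ> ?f) A \<in> K \<inter> ?F N} = {A \<in> ?G. reduction N A \<in> K}"
    using red N by (auto simp: space)
  finally have "closedin (GL2_topology S) {A \<in> ?G. reduction N A \<in> K}" .
  moreover have "{A \<in> H. reduction N A \<in> K} = {A \<in> ?G. reduction N A \<in> K} \<inter> H"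
    using H by blast
  ultimately show ?thesis unfolding closedin_subtopology by blast
qed

text \<open>
  If \<open>B\<close> in the pullback of \<open>K\<close> has the right determinant modulo
  \<open>N\<close>, the remaining factor \<open>w\<close> is congruent to \<open>1\<close>
  modulo \<open>N\<close>. Then \<open>diag(w, 1)\<close> lies in the kernel of reduction
  modulo the level \<open>N\<close>, so multiplying \<open>B\<close> by it corrects the
  determinant without leaving the pullback.
\<close>
lemma det2_reduction_preimage:
  assumes N: "N \<in> S_numbers S" and H: "subgroup H (GL2 (Z_S S))"
    and level: "H = {A \<in> carrier (GL2 (Z_S S)). reduction N A \<in> reduction N ` H}"
    and det: "det2 (Z_S S) ` H = Units (Z_S S)"
    and K: "K \<subseteq> reduction N ` H"
    and det_K: "det2 (ZFact (int N)) ` K = det2 (ZFact (int N)) ` (reduction N ` H)"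
  shows "det2 (Z_S S) ` {A \<in> H. reduction N A \<in> K} = Units (Z_S S)"
proof (intro equalityI subsetI)
  interpret R: cring "Z_S S" by (rule Z_S_is_cring)
  interpret F: cring "ZFact (int N)" by (rule ZFact_is_cring)
  interpret GL: group "GL2 (Z_S S)" by (rule R.GL2_group)
  interpret GLN: group "GL2 (ZFact (int N))" by (rule F.GL2_group)
  interpret ev: ring_hom_cring "Z_S S" "ZFact (int N)" "\<lambda>x. x N"
    using N by (rule Z_S_eval_ring_hom_cring)
  have mat: "A \<in> carrier (Mat2 (Z_S S))" if "A \<in> H" for A
    using subgroup.mem_carrier[OF H that] by (simp add: R.GL2_carrier)
  fix u assume u: "u \<in> Units (Z_S S)"
  then obtain A where A: "A \<in> H" "det2 (Z_S S) A = u" using det by (metis imageE)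
  then have "det2 (ZFact (int N)) (reduction N A) \<in> det2 (ZFact (int N)) ` K" unfolding det_K by blast
  then obtain B where B: "B \<in> H" "reduction N B \<in> K"
      "det2 (ZFact (int N)) (reduction N A) = det2 (ZFact (int N)) (reduction N B)"
    using K by auto
  let ?d = "det2 (Z_S S) B"
  have d: "?d \<in> Units (Z_S S)" using B(1) det by blast
  \<comment> \<open>The quotient of the wanted determinant by the one of \<open>B\<close>.\<close>
  let ?w = "inv\<^bsub>Z_S S\<^esub> ?d \<otimes>\<^bsub>Z_S S\<^esub> u"
  have w: "?w \<in> Units (Z_S S)" using d u by simp
  have wc: "?w \<in> carrier (Z_S S)" using w by (rule R.Units_closed)
  have "u N = ?d N"
    using B(3) A det2_reduction[OF N mat] B(1) by metis
  then have wN: "?w N = \<one>\<^bsub>ZFact (int N)\<^esub>"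
    using d R.Units_closed[OF d] R.Units_closed[OF u]
    by (metis R.Units_inv_closed R.Units_l_inv ev.hom_mult ev.hom_one)
  let ?C = "mat2 ?w \<zero>\<^bsub>Z_S S\<^esub> \<zero>\<^bsub>Z_S S\<^esub> \<one>\<^bsub>Z_S S\<^esub>"
  have detC: "det2 (Z_S S) ?C = ?w" using wc by (simp add: det2_def R.minus_eq)
  have C: "?C \<in> carrier (GL2 (Z_S S))"
    using w wc unfolding R.GL2_carrier mem_Collect_eq detC by (simp add: Mat2_carrier_iff)
  have redC: "reduction N ?C = \<one>\<^bsub>GL2 (ZFact (int N))\<^esub>"
    by (simp add: reduction_mat2 GL2_one wN)
  have Bc: "B \<in> carrier (GL2 (Z_S S))" using H B(1) by (rule subgroup.mem_carrier)
  let ?BC = "B \<otimes>\<^bsub>GL2 (Z_S S)\<^esub> ?C"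
  have "reduction N ?BC = reduction N B"
    using hom_mult[OF reduction_hom[OF N] Bc C] redC hom_in_carrier[OF reduction_hom[OF N] Bc] by simp
  moreover have "?BC \<in> carrier (GL2 (Z_S S))" using Bc C by simp
  ultimately have BC: "?BC \<in> {A \<in> H. reduction N A \<in> K}"
    using B(1,2) by (subst level) auto
  have "det2 (Z_S S) ?BC = u"
  proof -
    have "det2 (Z_S S) ?BC = ?d \<otimes>\<^bsub>Z_S S\<^esub> ?w"
      using hom_mult[OF R.det2_hom Bc C] detC by (simp add: units_of_mult)
    also have "\<dots> = u" using d R.Units_closed[OF d] R.Units_closed[OF u] by (simp flip: R.m_assoc)
    finally show ?thesis .
  qed
  then show "u \<in> det2 (Z_S S) ` {A \<in> H. reduction N A \<in> K}"
    by (rule image_eqI[OF sym BC])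
qed (use det in blast)

text \<open>
  A closed subgroup of \<open>H\<close> that contains the kernel of reduction modulo
  \<open>N\<close> is determined by its finite image. Hence a proper subgroup of the image
  that is maximal among those containing \<open>K\<close> pulls back to a maximal closed
  subgroup of \<open>H\<close>, and minimality of \<open>H\<close> applies to it.
\<close>
lemma minimal_group_no_proper_subgroup_onto:
  assumes min: "minimal_group S H" and N: "N \<in> S_numbers S" "N > 0"
    and level: "H = {A \<in> carrier (GL2 (Z_S S)). reduction N A \<in> reduction N ` H}"
    and K: "subgroup K (GL2 (ZFact (int N)))" "K \<subseteq> reduction N ` H"
    and det_K: "det2 (ZFact (int N)) ` K = det2 (ZFact (int N)) ` (reduction N ` H)"
  shows "K = reduction N ` H"
proof (rule ccontr)
  assume "K \<noteq> reduction N ` H"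
  interpret R: cring "Z_S S" by (rule Z_S_is_cring)
  interpret F: cring "ZFact (int N)" by (rule ZFact_is_cring)
  interpret red: group_hom "GL2 (Z_S S)" "GL2 (ZFact (int N))" "reduction N"
    using R.GL2_group F.GL2_group reduction_hom[OF N(1)]
    by (simp add: group_hom_def group_hom_axioms_def)
  have H: "subgroup H (GL2 (Z_S S))" and det: "det2 (Z_S S) ` H = Units (Z_S S)"
    using min by (simp_all add: minimal_group_def)
  have HG: "H \<subseteq> carrier (GL2 (Z_S S))" using H by (rule subgroup.subset)
  let ?L = "{L. subgroup L (GL2 (ZFact (int N))) \<and> L \<subset> reduction N ` H}"
  have "finite (reduction N ` H)"
  proof (rule finite_subset)
    show "reduction N ` H \<subseteq> carrier (GL2 (ZFact (int N)))" using HG by auto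
    show "finite (carrier (GL2 (ZFact (int N))))"
      using N(2) by (intro finite_GL2 ZFact_is_cring finite_ZFact) simp
  qed
  then have "finite ?L" by (rule rev_finite_subset[OF finite_Pow_iff[THEN iffD2]]) blast
  moreover have "K \<in> ?L" using K \<open>K \<noteq> reduction N ` H\<close> by blast
  ultimately have "\<exists>L\<in>?L. K \<subseteq> L \<and> (\<forall>L'\<in>?L. L \<subseteq> L' \<longrightarrow> L = L')"
    by (rule finite_has_maximal2)
  then obtain L where L_mem: "L \<in> ?L" and L_max: "K \<subseteq> L \<and> (\<forall>L'\<in>?L. L \<subseteq> L' \<longrightarrow> L = L')"
    by (rule bexE)
  have L: "subgroup L (GL2 (ZFact (int N)))" "L \<subset> reduction N ` H" "K \<subseteq> L"
    using L_mem L_max by simp_all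
  have L_sub: "L \<subseteq> reduction N ` H" using L(2) by (rule psubset_imp_subset)
  let ?M = "{A \<in> H. reduction N A \<in> L}"
  have red_M: "reduction N ` ?M = L" using L_sub by blast
  have "subgroup ?M (GL2 (Z_S S))"
  proof (rule group.subgroupI[OF R.GL2_group])
    show "?M \<subseteq> carrier (GL2 (Z_S S))" using HG by blast
    have "L \<noteq> {}" using subgroup.one_closed[OF L(1)] by blast
    then show "?M \<noteq> {}" using red_M by blast
  next
    fix A assume "A \<in> ?M"
    moreover from this have "A \<in> carrier (GL2 (Z_S S))" using HG by blast
    ultimately show "inv\<^bsub>GL2 (Z_S S)\<^esub> A \<in> ?M"
      using subgroup.m_inv_closed[OF H] subgroup.m_inv_closed[OF L(1)] by simp
  next
    fix A B assume "A \<in> ?M" "B \<in> ?M"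
    moreover from this have "A \<in> carrier (GL2 (Z_S S))" "B \<in> carrier (GL2 (Z_S S))" using HG by blast+
    ultimately show "A \<otimes>\<^bsub>GL2 (Z_S S)\<^esub> B \<in> ?M"
      using subgroup.m_closed[OF H] subgroup.m_closed[OF L(1)] by simp
  qed
  then have closed_M: "closed_subgroup_of S H ?M"
    using closedin_reduction_preimage[OF N(1) HG, of L] by (simp add: closed_subgroup_of_def)
  have "?M = K' \<or> H = K'" if K': "closed_subgroup_of S H K'" "?M \<subseteq> K'" for K'
  proof -
    have sub: "subgroup K' (GL2 (Z_S S))" "K' \<subseteq> H" using K'(1) by (auto simp: closed_subgroup_of_def)
    have "subgroup (reduction N ` K') (GL2 (ZFact (int N)))"
      using red.subgroup_img_is_subgroup[OF sub(1)] .
    moreover have "L \<subseteq> reduction N ` K'" using red_M K'(2) by blast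
    moreover have "reduction N ` K' \<subseteq> reduction N ` H" using sub(2) by (rule image_mono)
    ultimately have cases: "reduction N ` K' = L \<or> reduction N ` K' = reduction N ` H"
      using L_max by auto
    have "A \<in> K'" if A: "A \<in> H" "reduction N A \<in> reduction N ` K'" for A
    proof -
      obtain B where B: "B \<in> K'" "reduction N A = reduction N B" using A(2) by blast
      have Ac: "A \<in> carrier (GL2 (Z_S S))" and Bc: "B \<in> carrier (GL2 (Z_S S))"
        using A(1) B(1) HG sub(2) by auto
      let ?D = "inv\<^bsub>GL2 (Z_S S)\<^esub> B \<otimes>\<^bsub>GL2 (Z_S S)\<^esub> A"
      have "reduction N ?D = \<one>\<^bsub>GL2 (ZFact (int N))\<^esub>"
        using Ac Bc B(2) by simp
      moreover have "\<one>\<^bsub>GL2 (ZFact (int N))\<^esub> \<in> L" using subgroup.one_closed[OF L(1)] .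
      moreover have "?D \<in> H"
        using A(1) B(1) sub(2) subgroup.m_closed[OF H] subgroup.m_inv_closed[OF H] by blast
      ultimately have "?D \<in> K'" using K'(2) by auto
      then have "B \<otimes>\<^bsub>GL2 (Z_S S)\<^esub> ?D \<in> K'" using B(1) subgroup.m_closed[OF sub(1)] by blast
      also have "B \<otimes>\<^bsub>GL2 (Z_S S)\<^esub> ?D = A" using Ac Bc by (metis red.G.inv_closed red.G.l_one red.G.m_assoc red.G.r_inv)
      finally show ?thesis .
    qed
    then have "K' = {A \<in> H. reduction N A \<in> reduction N ` K'}" using sub(2) by blast
    with cases show ?thesis by auto
  qed
  moreover have "?M \<noteq> H" using red_M L(2) by auto
  ultimately have "maximal_closed_subgroup_of S H ?M"
    using closed_M unfolding maximal_closed_subgroup_of_def by blast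
  then have "det2 (Z_S S) ` ?M \<noteq> Units (Z_S S)"
    using min by (auto simp only: minimal_group_def)
  moreover have "det2 (ZFact (int N)) ` L = det2 (ZFact (int N)) ` (reduction N ` H)"
    using image_mono[OF L(3), of "det2 (ZFact (int N))"] image_mono[OF L_sub, of "det2 (ZFact (int N))"] det_K by simp
  ultimately show False
    using det2_reduction_preimage[OF N(1) H level det L_sub] by blast
qed

section \<open>Integer matrices modulo an integer\<close>

definition int_mat :: "int \<Rightarrow> int \<Rightarrow> int \<Rightarrow> int \<Rightarrow> int \<Rightarrow> (int set)^2^2" where
  "int_mat k a b c d = mat2 (ZMod k a) (ZMod k b) (ZMod k c) (ZMod k d)"

lemma int_mat_eq_iff:
  "int_mat k a b c d = int_mat k a' b' c' d' \<longleftrightarrow>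
    [a = a'] (mod k) \<and> [b = b'] (mod k) \<and> [c = c'] (mod k) \<and> [d = d'] (mod k)"
  by (simp add: int_mat_def mat2_eq_iff ZMod_eq_iff)

lemma int_mat_mult:
  "int_mat k a b c d \<otimes>\<^bsub>GL2 (ZFact k)\<^esub> int_mat k a' b' c' d' =
    int_mat k (a * a' + b * c') (a * b' + b * d') (c * a' + d * c') (c * b' + d * d')"
  by (rule mat2_eqI) (simp_all add: int_mat_def GL2_mult Mat2_mult_nth ZMod_mult ZMod_add)

lemma int_mat_one: "\<one>\<^bsub>GL2 (ZFact k)\<^esub> = int_mat k 1 0 0 1"
  by (simp add: GL2_one int_mat_def ZMod_one ZMod_zero)

lemma det2_int_mat: "det2 (ZFact k) (int_mat k a b c d) = ZMod k (a * d - b * c)"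
proof -
  interpret cring "ZFact k" by (rule ZFact_is_cring)
  show ?thesis by (simp add: det2_def int_mat_def minus_eq ZMod_mult ZMod_add ZMod_minus)
qed

lemma GL2_ZFact_int_matE:
  assumes "A \<in> carrier (GL2 (ZFact k))"
  obtains a b c d where "A = int_mat k a b c d"
proof -
  interpret cring "ZFact k" by (rule ZFact_is_cring)
  have A: "A \<in> carrier (Mat2 (ZFact k))" using assms by (simp add: GL2_carrier)
  then obtain a b c d where "A $ 1 $ 1 = ZMod k a" "A $ 1 $ 2 = ZMod k b" "A $ 2 $ 1 = ZMod k c" "A $ 2 $ 2 = ZMod k d"
    unfolding Mat2_carrier_iff carrier_ZFact by blast
  then have "A = int_mat k a b c d" by (intro mat2_eqI) (simp_all add: int_mat_def)
  then show thesis by (rule that)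
qed

lemma upper_unipotent_pow:
  "int_mat k 1 x 0 1 [^]\<^bsub>GL2 (ZFact k)\<^esub> (m::nat) = int_mat k 1 (int m * x) 0 1"
proof (induction m)
  case (Suc m)
  then show ?case by (simp add: int_mat_mult algebra_simps)
qed (simp add: int_mat_one)

lemma lower_unipotent_pow:
  "int_mat k 1 0 x 1 [^]\<^bsub>GL2 (ZFact k)\<^esub> (m::nat) = int_mat k 1 0 (int m * x) 1"
proof (induction m)
  case (Suc m)
  then show ?case by (simp add: int_mat_mult algebra_simps)
qed (simp add: int_mat_one)

section \<open>The contradiction at an odd prime\<close>

text \<open>
  An integer matrix of determinant \<open>1\<close> lifts to \<open>GL2\<close> over
  \<open>\<int>\<^sub>S\<close>, and the lift agrees with the identity modulo the level.
\<close>
lemma int_mat_in_level_subgroup: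
  assumes n: "n \<in> S_numbers S" and H: "subgroup H (GL2 (Z_S S))"
    and level: "H = {A \<in> carrier (GL2 (Z_S S)). reduction n A \<in> reduction n ` H}"
    and det: "a * d - b * c = 1"
    and cong: "[a = 1] (mod int n)" "[b = 0] (mod int n)" "[c = 0] (mod int n)" "[d = 1] (mod int n)"
    and N: "N \<in> S_numbers S"
  shows "int_mat (int N) a b c d \<in> reduction N ` H"
proof -
  interpret cring "Z_S S" by (rule Z_S_is_cring)
  let ?A = "mat2 (Z_S_of_int S a) (Z_S_of_int S b) (Z_S_of_int S c) (Z_S_of_int S d)"
  have mat: "?A \<in> carrier (Mat2 (Z_S S))" by (simp add: Mat2_carrier_iff Z_S_of_int_carrier)
  have red: "reduction m ?A = int_mat (int m) a b c d" if "m \<in> S_numbers S" for m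
    using that by (simp add: reduction_mat2 int_mat_def Z_S_of_int_at)
  have "det2 (Z_S S) ?A = \<one>\<^bsub>Z_S S\<^esub>"
  proof (rule Z_S_eqI[where S = S])
    fix m assume m: "m \<in> S_numbers S"
    show "det2 (Z_S S) ?A m = \<one>\<^bsub>Z_S S\<^esub> m"
      using m by (simp add: det2_reduction[OF m mat, symmetric] red det2_int_mat det Z_S_simps ZMod_one)
  qed (simp_all add: det2_closed mat)
  then have A: "?A \<in> carrier (GL2 (Z_S S))" using mat by (simp add: GL2_carrier)
  have "reduction n ?A = \<one>\<^bsub>GL2 (ZFact (int n))\<^esub>"
    using cong by (simp add: red n int_mat_one int_mat_eq_iff)
  also have "\<dots> = reduction n \<one>\<^bsub>GL2 (Z_S S)\<^esub>"
    using n by (simp add: GL2_one reduction_mat2 Z_S_simps)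
  finally have "?A \<in> H" 
    using A subgroup.one_closed[OF H] by (subst level) auto
  then show ?thesis using red[OF N] by (metis image_eqI)
qed

lemma minimal_group_imp_prime_eq_2:
  assumes S: "finite S" "\<forall>p\<in>S. prime p"
    and min: "minimal_group S H" and fl: "finite_level S H"
    and q: "q \<in> S"
  shows "q = 2"
proof (rule ccontr)
  assume "q \<noteq> 2"
  have q_prime: "prime q" using S(2) q by blast
  obtain u :: int where u: "\<And>p. p \<in> S \<Longrightarrow> coprime u (int p)"
      "\<And>m a. odd m \<Longrightarrow> \<not> [u ^ m = a\<^sup>2] (mod int q)"
    using exists_unit_with_nonsquare_odd_powers[OF S q \<open>q \<noteq> 2\<close>] by blast
  obtain n where n: "n \<in> S_numbers S" and level_n: "H = {A \<in> carrier (GL2 (Z_S S)). reduction n A \<in> reduction n ` H}"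
    using fl unfolding finite_level_def by blast
  \<comment> \<open>The extra factor \<open>q\<close> keeps the elementary matrices with entry \<open>n\<close> visible, with order \<open>q\<close>.\<close>
  define N where "N = n * q"
  have "n > 0" using n by (simp add: S_numbers_def)
  have N: "N \<in> S_numbers S" "N > 0"
    using n q q_prime by (auto simp: N_def S_numbers_def prime_factors_product prime_prime_factors prime_gt_0_nat)
  have level_N: "H = {A \<in> carrier (GL2 (Z_S S)). reduction N A \<in> reduction N ` H}"
    using level_multiple[OF level_n n N(1)] by (simp add: N_def)
  interpret R: cring "Z_S S" by (rule Z_S_is_cring)
  interpret F: cring "ZFact (int N)" by (rule ZFact_is_cring)
  interpret red: group_hom "GL2 (Z_S S)" "GL2 (ZFact (int N))" "reduction N"
    using R.GL2_group F.GL2_group reduction_hom[OF N(1)]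
    by (simp add: group_hom_def group_hom_axioms_def)
  have H: "subgroup H (GL2 (Z_S S))" and det_H: "det2 (Z_S S) ` H = Units (Z_S S)"
    using min by (simp_all add: minimal_group_def)
  let ?F = "GL2 (ZFact (int N))" and ?d = "det2 (ZFact (int N))"
  define G where "G = reduction N ` H"
  let ?FG = "?F\<lparr>carrier := G\<rparr>"
  have G: "subgroup G ?F" unfolding G_def by (rule red.subgroup_img_is_subgroup[OF H])
  interpret G: group ?FG using red.H.subgroup_imp_group[OF G] .
  have fin: "finite (carrier ?FG)"
    using finite_subset[OF subgroup.subset[OF G] finite_GL2[OF ZFact_is_cring finite_ZFact]] N(2) by simp
  have D: "comm_group (units_of (ZFact (int N)))" by (rule F.units_comm_group)
  have d_hom: "?d \<in> hom ?FG (units_of (ZFact (int N)))"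
    using hom_in_carrier[OF F.det2_hom] hom_mult[OF F.det2_hom] subgroup.mem_carrier[OF G]
    by (intro homI) simp_all
  have minimal: "K = carrier ?FG" if "subgroup K ?FG" "?d ` K = ?d ` carrier ?FG" for K
    using minimal_group_no_proper_subgroup_onto[OF min N level_N, of K]
      red.H.incl_subgroup[OF G that(1)] subgroup.subset[OF that(1)] that(2) by (simp add: G_def)

  obtain A where A: "A \<in> H" "det2 (Z_S S) A = Z_S_of_int S u"
    using det_H Z_S_of_int_unit[of S u] u(1) by (metis imageE)
  let ?A = "reduction N A"
  have AG: "?A \<in> G" using A(1) by (simp add: G_def)
  have det_A: "?d ?A = ZMod (int N) u"
  proof -
    have "A \<in> carrier (Mat2 (Z_S S))" using subgroup.mem_carrier[OF H A(1)] by (simp add: R.GL2_carrier)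
    then show ?thesis using det2_reduction[OF N(1)] A(2) Z_S_of_int_at[OF N(1)] by simp
  qed
  \<comment> \<open>Taking the power by the odd part \<open>m\<close> of the group order leaves an element of 2-power order.\<close>
  have "order ?FG \<noteq> 0" using fin G.order_gt_0_iff_finite by simp
  then obtain i m where im: "order ?FG = 2 ^ i * m" "odd m"
    using multiplicity_decompose'[of "order ?FG" 2] by (metis not_prime_unit two_is_prime_nat)
  define g where "g = ?A [^]\<^bsub>?FG\<^esub> m"
  have g: "g \<in> carrier ?FG" using AG G.nat_pow_closed[of ?A m] by (simp add: g_def)
  have g_pow: "g [^]\<^bsub>?FG\<^esub> ((2::nat) ^ i) = \<one>\<^bsub>?FG\<^esub>"
    using G.pow_order_eq_1[of ?A] AG im(1) by (simp add: g_def G.nat_pow_pow mult.commute)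
  have commute: "g \<otimes>\<^bsub>?F\<^esub> h = h \<otimes>\<^bsub>?F\<^esub> g" if "h \<in> G" "h [^]\<^bsub>?F\<^esub> q = \<one>\<^bsub>?F\<^esub>" for h
    using G.commute_if_no_proper_subgroup_onto[OF fin D d_hom minimal two_is_prime_nat q_prime _ g g_pow, of h 1]
      that \<open>q \<noteq> 2\<close> by (simp flip: red.H.nat_pow_consistent)
  have "g \<in> carrier ?F" using g subgroup.subset[OF G] by auto
  then obtain a b c d where g_eq: "g = int_mat N a b c d" by (rule GL2_ZFact_int_matE)
  have "[a * d - b * c = u ^ m] (mod int N)"
  proof -
    have "?d (?A [^]\<^bsub>?F\<^esub> k) = ZMod (int N) (u ^ k)" for k :: nat
    proof (induction k)
      case 0
      show ?case by (simp add: int_mat_one det2_int_mat)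
    next
      case (Suc k)
      have "?A \<in> carrier ?F" using AG subgroup.subset[OF G] by auto
      then show ?case
        using hom_mult[OF F.det2_hom, of "?A [^]\<^bsub>?F\<^esub> k" ?A] Suc
        by (simp add: units_of_mult det_A ZMod_mult mult.commute)
    qed
    from this[of m] show ?thesis
      using g_eq by (simp add: g_def det2_int_mat ZMod_eq_iff flip: red.H.nat_pow_consistent)
  qed
  moreover have "int q dvd int N" by (simp add: N_def)
  ultimately have det_g: "[a * d - b * c = u ^ m] (mod int q)" by (rule cong_dvd_modulus)
  let ?U = "int_mat N 1 n 0 1" and ?L = "int_mat N 1 0 n 1"
  have "?U \<in> G" "?L \<in> G"
    unfolding G_def by (rule int_mat_in_level_subgroup[OF n H level_n _ _ _ _ _ N(1)]; simp add: cong_0_iff)+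
  moreover have "?U [^]\<^bsub>?F\<^esub> q = \<one>\<^bsub>?F\<^esub>" "?L [^]\<^bsub>?F\<^esub> q = \<one>\<^bsub>?F\<^esub>"
    by (simp_all add: upper_unipotent_pow lower_unipotent_pow int_mat_one int_mat_eq_iff cong_0_iff N_def)
  ultimately have "g \<otimes>\<^bsub>?F\<^esub> ?U = ?U \<otimes>\<^bsub>?F\<^esub> g" "g \<otimes>\<^bsub>?F\<^esub> ?L = ?L \<otimes>\<^bsub>?F\<^esub> g"
    using commute by blast+
  \<comment> \<open>Cancelling \<open>n\<close> from the entries of both commutation relations leaves \<open>g\<close> scalar modulo \<open>q\<close>.\<close>
  then have "[a = a + n * c] (mod int N)" "[a * n + b = b + n * d] (mod int N)" "[a + b * n = a] (mod int N)"
    by (simp_all add: g_eq int_mat_mult int_mat_eq_iff)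
  then have "int N dvd n * c" "int N dvd n * (a - d)" "int N dvd n * b"
    by (simp_all add: cong_iff_dvd_diff algebra_simps)
  then have "int q dvd c" "int q dvd a - d" "int q dvd b"
    using \<open>n > 0\<close> by (simp_all add: N_def)
  then have "[a * d - b * c = a * a - 0 * 0] (mod int q)"
    by (intro cong_diff cong_mult cong_refl) (simp_all add: cong_iff_dvd_diff cong_0_iff dvd_diff_commute)
  then have "[u ^ m = a\<^sup>2] (mod int q)"
    using det_g cong_sym cong_trans by (metis diff_zero mult_zero_left power2_eq_square)
  with u(2)[OF im(2)] show False by blast
qed

theorem theorem1p3:
  fixes S :: "nat set" and H :: "((nat \<Rightarrow> int set)^2^2) set"
  assumes "finite S" and "S \<noteq> {}" and "\<forall>p\<in>S. prime p"
    and "minimal_group S H"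
    and "finite_level S H"
  shows "S = {2}"
  using minimal_group_imp_prime_eq_2[OF assms(1,3,4,5)] assms(2) by blast

end
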